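(* Let $X$ be an infinite-dimensional complex normed space. Then there are $\varepsilon>0$ and unit vectors $(x_n)_{n=1}^\infty\subset X$ such that $$\|x_n-\theta x_m\|\ge 1+\varepsilon\qquad (n\ne m,\ \theta\in\mathbb C,\ |\theta|=1).$$ Equivalently, $d_{\mathbb T}(x_n,x_m)\ge 1+\varepsilon$ for all $n\neq m$.
   Context: For unit vectors $x,y$ of a complex normed space, $d_{\mathbb T}(x,y)=\inf_{\theta\in\mathbb C,\,|\theta|=1}\|x-\theta y\|$. The space $X$ is not assumed to be complete. *)

theory Defs
  imports "HOL-Analysis.Analysis"
begin

class scaleC =
  fixes scaleC :: "complex \<Rightarrow> 'a \<Rightarrow> 'a" (infixr "*\<^sub>C" 75)

text \<open>Complex normed spaces, not necessarily complete. The real structure, and with it the norm,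
  metric and topology, comes from \<^class>\<open>real_normed_vector\<close>; \<open>scaleR_scaleC\<close> ties it to the
  complex scalar multiplication.\<close>

class complex_normed_vector = real_normed_vector + scaleC +
  assumes scaleC_add_right: "a *\<^sub>C (x + y) = a *\<^sub>C x + a *\<^sub>C y"
    and scaleC_add_left: "(a + b) *\<^sub>C x = a *\<^sub>C x + b *\<^sub>C x"
    and scaleC_scaleC: "a *\<^sub>C b *\<^sub>C x = (a * b) *\<^sub>C x"
    and scaleC_one: "1 *\<^sub>C x = x"
    and scaleR_scaleC: "r *\<^sub>R x = complex_of_real r *\<^sub>C x"
    and norm_scaleC: "norm (a *\<^sub>C x) = cmod a * norm x"

global_interpretation complex_vector:
  vector_space "scaleC :: complex \<Rightarrow> 'a \<Rightarrow> 'a::complex_normed_vector"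
  by unfold_locales (simp_all add: scaleC_add_right scaleC_add_left scaleC_scaleC scaleC_one)

definition infinite_dimensional :: "'a::complex_normed_vector itself \<Rightarrow> bool" where
  "infinite_dimensional _ \<longleftrightarrow> (\<nexists>B::'a set. finite B \<and> complex_vector.span B = UNIV)"

definition dist_T :: "'a::complex_normed_vector \<Rightarrow> 'a \<Rightarrow> real" where
  "dist_T x y = (INF \<theta>\<in>{\<theta>. cmod \<theta> = 1}. norm (x - \<theta> *\<^sub>C y))"

end

theory Submission imports Defs begin

text \<open>Suppose that no \<open>(1 + \<epsilon>)\<close>-separated sequence exists. Then every set of vectors of norm at most \<open>R\<close>
  that is invariant under rotations is covered, for each \<open>R' > R\<close>, by finitely many balls of radius
  \<open>R'\<close> centred in the set itself.

  Fix an ultrafilter \<open>U\<close> on the unit sphere all of whose members have \<open>0\<close> in their closed convex hull, and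
  consider the game in which a position \<open>s\<close> moves to \<open>s + c y\<close> with a unimodular \<open>c\<close> of the player's choice and
  a \<open>U\<close>-generic \<open>y\<close>, the norm having to stay below \<open>r\<close>. By transfinite induction \<open>0\<close> is not lost at any stage,
  for any \<open>r > 1\<close>: if \<open>0\<close> were lost at \<open>r'\<close> one stage after it survives at some \<open>r < r'\<close>, the covering property
  of the lost positions would allow one of them to be prepended to the surviving play for \<open>r\<close>, and it
  would survive at \<open>r'\<close> itself.

  So there is a bounded nonempty set of positions closed under suitable generic moves. Use only
  moves with \<open>c\<close> in one of finitely many small discs, and take a minimal family of discs that
  suffices. For a disc of this family, the closed convex hull of the positions that can move with \<open>c\<close> in it contains
  all positions, for otherwise the disc could be omitted. In this hull the disc is always
  available, which yields unit vectors whose sums over finite sets are bounded, that is, a copy of \<open>c\<^sub>0\<close>.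
  James' distortion argument makes it almost isometric, where separated vectors are explicit.\<close>

section \<open>Weakly null ultrafilters on the unit sphere\<close>


text \<open>Positive homogeneity is demanded only as an inequality, which is easier to check for
  infima; scaling back by the inverse factor gives equality.\<close>

definition sublinear :: "('a::real_vector \<Rightarrow> real) \<Rightarrow> bool" where
  "sublinear p \<longleftrightarrow> p 0 = 0 \<and> (\<forall>x y. p (x + y) \<le> p x + p y) \<and> (\<forall>t>0. \<forall>x. p (t *\<^sub>R x) \<le> t * p x)"

lemma sublinear_add: "sublinear p \<Longrightarrow> p (x + y) \<le> p x + p y"
  by (simp add: sublinear_def)

lemma sublinear_scaleR:
  assumes "sublinear p" "t \<ge> 0"
  shows "p (t *\<^sub>R x) = t * p x"
proof (cases "t = 0")
  case True
  then show ?thesis using assms by (simp add: sublinear_def)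
next
  case False
  then have t: "t > 0" using assms by simp
  have "p (inverse t *\<^sub>R (t *\<^sub>R x)) \<le> inverse t * p (t *\<^sub>R x)"
    using assms t positive_imp_inverse_positive unfolding sublinear_def by blast
  then have "t * p x \<le> p (t *\<^sub>R x)" using t by (simp add: field_simps)
  moreover have "p (t *\<^sub>R x) \<le> t * p x" using assms t by (simp add: sublinear_def)
  ultimately show ?thesis by simp
qed

lemma sublinear_minus_le: "sublinear p \<Longrightarrow> - p (- x) \<le> p x"
  using sublinear_add[of p x "- x"] by (simp add: sublinear_def)

text \<open>The bound \<open>- p (- x)\<close> below every member keeps the infimum finite. For
  subadditivity, the members used at \<open>x\<close> and at \<open>y\<close> are both replaced by
  the smaller of the two. This supplies the chain bounds for Zorn's lemma.\<close>

lemma sublinear_Inf_chain: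
  assumes C: "C \<noteq> {}" "\<And>q. q \<in> C \<Longrightarrow> sublinear q" "\<And>q. q \<in> C \<Longrightarrow> q \<le> p"
    and chain: "\<And>q q'. q \<in> C \<Longrightarrow> q' \<in> C \<Longrightarrow> q \<le> q' \<or> q' \<le> q"
  shows "sublinear (\<lambda>x. INF q\<in>C. q x)" and "q \<in> C \<Longrightarrow> (\<lambda>x. INF q\<in>C. q x) \<le> q"
proof -
  have low: "- p (- x) \<le> q x" if "q \<in> C" for q x
  proof -
    have "q (- x) \<le> p (- x)" using C(3)[OF that] by (simp add: le_fun_def)
    then show ?thesis using sublinear_minus_le[OF C(2)[OF that], of x] by linarith
  qed
  have bdd: "bdd_below ((\<lambda>q. q x) ` C)" for x
    using low by (intro bdd_belowI2) auto
  have le: "(INF q\<in>C. q x) \<le> q x" if "q \<in> C" for q x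
    using bdd that by (intro cINF_lower)
  then show "q \<in> C \<Longrightarrow> (\<lambda>x. INF q\<in>C. q x) \<le> q" by (simp add: le_fun_def)
  have z: "(INF q\<in>C. q 0) = 0"
  proof -
    have "(INF q\<in>C. q 0) = (INF q\<in>C. 0 :: real)"
      using C(2) by (intro INF_cong) (auto simp: sublinear_def)
    then show ?thesis using C(1) by simp
  qed
  have sub: "(INF q\<in>C. q (x + y)) \<le> (INF q\<in>C. q x) + (INF q\<in>C. q y)" for x y
  proof -
    have "(INF q\<in>C. q (x + y)) \<le> q1 x + q2 y" if q: "q1 \<in> C" "q2 \<in> C" for q1 q2
    proof -
      obtain q where "q \<in> C" "q \<le> q1" "q \<le> q2" using chain q by blast
      then have "q x \<le> q1 x" "q y \<le> q2 y" by (simp_all add: le_fun_def)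
      then show ?thesis
        using le[OF \<open>q \<in> C\<close>, of "x + y"] sublinear_add[OF C(2)[OF \<open>q \<in> C\<close>], of x y] by linarith
    qed
    then have "(INF q\<in>C. q (x + y)) - q1 x \<le> q2 y" if "q1 \<in> C" "q2 \<in> C" for q1 q2
      using that by (simp add: diff_le_eq add.commute[of "q2 y"])
    then have "(INF q\<in>C. q (x + y)) - q1 x \<le> (INF q\<in>C. q y)" if "q1 \<in> C" for q1
      using that C(1) by (intro cINF_greatest)
    then have "(INF q\<in>C. q (x + y)) - (INF q\<in>C. q y) \<le> q1 x" if "q1 \<in> C" for q1
      using that by (metis diff_le_eq add.commute)
    then have "(INF q\<in>C. q (x + y)) - (INF q\<in>C. q y) \<le> (INF q\<in>C. q x)"
      using C(1) by (intro cINF_greatest)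
    then show ?thesis by simp
  qed
  have hom: "(INF q\<in>C. q (t *\<^sub>R x)) \<le> t * (INF q\<in>C. q x)" if t: "t > 0" for t x
  proof -
    have "(INF q\<in>C. q (t *\<^sub>R x)) / t \<le> q x" if "q \<in> C" for q
      using le[OF that, of "t *\<^sub>R x"] sublinear_scaleR[OF C(2)[OF that], of t x] t
      by (simp add: field_simps)
    then have "(INF q\<in>C. q (t *\<^sub>R x)) / t \<le> (INF q\<in>C. q x)"
      using C(1) by (intro cINF_greatest)
    then show ?thesis using t by (simp add: field_simps)
  qed
  show "sublinear (\<lambda>x. INF q\<in>C. q x)"
    unfolding sublinear_def using z sub hom by blast
qed

text \<open>Taking \<open>t = 0\<close> puts \<open>q'\<close> below \<open>q\<close>, and
  \<open>t = 1\<close> gives \<open>q' x + q z \<le> q (x + z)\<close>; so \<open>q' = q\<close> for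
  every \<open>z\<close> makes \<open>q\<close> additive.\<close>

lemma sublinear_shift:
  fixes z :: "'a::real_vector"
  assumes q: "sublinear q"
  defines "q' \<equiv> \<lambda>x. INF t\<in>{0..}. q (x + t *\<^sub>R z) - t * q z"
  shows "sublinear q'" and "t \<ge> 0 \<Longrightarrow> q' x \<le> q (x + t *\<^sub>R z) - t * q z"
proof -
  have low: "- q (- x) \<le> q (x + t *\<^sub>R z) - t * q z" if "t \<ge> 0" for x t
  proof -
    have "q (x + t *\<^sub>R z + - x) = t * q z" using sublinear_scaleR[OF q that, of z] by simp
    then show ?thesis using sublinear_add[OF q, of "x + t *\<^sub>R z" "- x"] by linarith
  qed
  have le: "q' x \<le> q (x + t *\<^sub>R z) - t * q z" if "t \<ge> 0" for x t
    unfolding q'_def using low that by (intro cINF_lower bdd_belowI2[where m="- q (- x)"]) auto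
  then show "t \<ge> 0 \<Longrightarrow> q' x \<le> q (x + t *\<^sub>R z) - t * q z" .
  have ge: "m \<le> q' x" if "\<And>t. t \<ge> 0 \<Longrightarrow> m \<le> q (x + t *\<^sub>R z) - t * q z" for m x
    unfolding q'_def using that by (intro cINF_greatest) auto
  have z0: "q' 0 = 0"
  proof (rule antisym)
    show "q' 0 \<le> 0" using le[of 0 0] q by (simp add: sublinear_def)
    show "0 \<le> q' 0" using sublinear_scaleR[OF q, of _ z] by (intro ge) simp
  qed
  have sub: "q' (x + y) \<le> q' x + q' y" for x y
  proof -
    have "q' (x + y) \<le> (q (x + s *\<^sub>R z) - s * q z) + (q (y + t *\<^sub>R z) - t * q z)"
      if "s \<ge> 0" "t \<ge> 0" for s t
    proof -
      have "x + s *\<^sub>R z + (y + t *\<^sub>R z) = x + y + (s + t) *\<^sub>R z" by (simp add: scaleR_add_left)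
      then have "q (x + y + (s + t) *\<^sub>R z) \<le> q (x + s *\<^sub>R z) + q (y + t *\<^sub>R z)"
        using sublinear_add[OF q, of "x + s *\<^sub>R z" "y + t *\<^sub>R z"] by metis
      then show ?thesis using le[of "s + t" "x + y"] that by (simp add: distrib_right)
    qed
    then have "q' (x + y) - (q (x + s *\<^sub>R z) - s * q z) \<le> q' y" if "s \<ge> 0" for s
      using that by (intro ge) (simp add: diff_le_eq add.commute)
    then have "q' (x + y) - q' y \<le> q' x" by (intro ge) (simp add: diff_le_eq add.commute)
    then show ?thesis by simp
  qed
  have hom: "q' (r *\<^sub>R x) \<le> r * q' x" if r: "r > 0" for r x
  proof -
    have "q' (r *\<^sub>R x) / r \<le> q (x + t *\<^sub>R z) - t * q z" if t: "t \<ge> 0" for t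
    proof -
      have "q (r *\<^sub>R x + (r * t) *\<^sub>R z) = r * q (x + t *\<^sub>R z)"
        using sublinear_scaleR[OF q, of r "x + t *\<^sub>R z"] r by (simp add: scaleR_add_right)
      then have "q' (r *\<^sub>R x) \<le> r * (q (x + t *\<^sub>R z) - t * q z)"
        using le[of "r * t" "r *\<^sub>R x"] t r by (simp add: right_diff_distrib mult.assoc)
      then show ?thesis using r by (simp add: pos_divide_le_eq mult.commute)
    qed
    then have "q' (r *\<^sub>R x) / r \<le> q' x" by (intro ge)
    then show ?thesis using r by (simp add: pos_divide_le_eq mult.commute)
  qed
  show "sublinear q'" unfolding sublinear_def using z0 sub hom by blast
qed

text \<open>A minimal sublinear functional is additive: shifting it along \<open>z\<close> gives a smaller sublinear
  functional, which must therefore agree with it.\<close>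

lemma Hahn_Banach_sublinear:
  fixes p :: "'a::real_vector \<Rightarrow> real"
  assumes p: "sublinear p"
  obtains f where "linear f" "f \<le> p"
proof -
  define A where "A = {q. sublinear q \<and> q \<le> p}"
  have "\<exists>m\<in>A. \<forall>a\<in>A. a \<le> m \<longrightarrow> a = m"
  proof (rule predicate_Zorn[where P="\<lambda>a b. b \<le> a"])
    show "partial_order_on A (relation_of (\<lambda>a b. b \<le> a) A)"
      by (rule partial_order_on_relation_ofI) auto
    fix C assume C: "C \<in> Chains (relation_of (\<lambda>a b. b \<le> a) A)"
    show "\<exists>u\<in>A. \<forall>a\<in>C. u \<le> a"
    proof (cases "C = {}")
      case True
      then show ?thesis using p by (auto simp: A_def)
    next
      case False
      have CA: "q \<in> A" if "q \<in> C" for q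
        using C that by (auto simp: Chains_def relation_of_def)
      have ch: "q \<le> q' \<or> q' \<le> q" if "q \<in> C" "q' \<in> C" for q q'
        using C that by (auto simp: Chains_def relation_of_def)
      have sl: "\<And>q. q \<in> C \<Longrightarrow> sublinear q" "\<And>q. q \<in> C \<Longrightarrow> q \<le> p"
        using CA by (auto simp: A_def)
      note inf = sublinear_Inf_chain[OF False sl ch]
      have "(\<lambda>x. INF q\<in>C. q x) \<le> p" using inf(2) sl(2) False by (meson ex_in_conv order_trans)
      then show ?thesis using inf by (auto simp: A_def)
    qed
  qed
  then obtain q where q: "sublinear q" "q \<le> p" and min: "\<And>a. sublinear a \<Longrightarrow> a \<le> q \<Longrightarrow> a = q"
    by (auto simp: A_def intro: order_trans)
  have add: "q (x + z) = q x + q z" for x z :: 'a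
  proof (rule antisym)
    show "q (x + z) \<le> q x + q z" using q by (simp add: sublinear_def)
    note sh = sublinear_shift[OF q(1), where z=z]
    have "(\<lambda>x. INF t\<in>{0..}. q (x + t *\<^sub>R z) - t * q z) = q"
      using sh(1) sh(2)[where t=0] by (intro min) (auto simp: le_fun_def)
    then show "q x + q z \<le> q (x + z)" using sh(2)[where t=1 and x=x] by (simp add: fun_eq_iff)
  qed
  have "q (- x) = - q x" for x using add[of x "- x"] q by (simp add: sublinear_def)
  then have "q (t *\<^sub>R x) = t * q x" for t x
    using sublinear_scaleR[OF q(1), of t x] sublinear_scaleR[OF q(1), of "- t" x]
    by (cases "t \<ge> 0") auto
  then have "linear q" using add by (intro linearI) auto
  then show thesis using q(2) by (rule that)
qed

section \<open>Separation from the origin and common kernels\<close>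

text \<open>Hahn-Banach is applied to the infimum \<open>p x\<close> of
  \<open>norm (x + t *\<^sub>R k) - t * \<delta>\<close> over \<open>t \<ge> 0\<close> and
  \<open>k \<in> C\<close>, where \<delta> bounds the norms on \<open>C\<close> from below. This
  choice of \<delta> gives \<open>p x \<ge> - norm x\<close>, and \<open>t = 1\<close> gives
  \<open>p (- k) \<le> - \<delta>\<close>.\<close>

lemma convex_separate_0:
  fixes C :: "'a::real_normed_vector set"
  assumes C: "convex C" "0 \<notin> closure C"
  obtains f :: "'a \<Rightarrow> real" and \<delta> where "linear f" "\<delta> > 0" "\<And>x. x \<in> C \<Longrightarrow> f x \<ge> \<delta>"
proof (cases "C = {}")
  case True
  moreover have "linear (\<lambda>x::'a. 0::real)" by (intro linearI) auto
  ultimately show ?thesis using that[of "\<lambda>x. 0" 1] by auto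
next
  case False
  obtain \<delta> where \<delta>: "\<delta> > 0" and \<delta>C: "\<And>k. k \<in> C \<Longrightarrow> norm k \<ge> \<delta>"
    using C(2) by (force simp: closure_approachable not_less)
  define S where "S = {0::real..} \<times> C"
  define g where "g x = (\<lambda>(t, k). norm (x + t *\<^sub>R k) - t * \<delta>)" for x :: 'a
  define p where "p x = (INF s\<in>S. g x s)" for x
  have low: "- norm x \<le> g x s" if s: "s \<in> S" for x s
  proof -
    obtain t k where tk: "s = (t, k)" "t \<ge> 0" "k \<in> C" using s by (auto simp: S_def)
    have "t * \<delta> \<le> norm (t *\<^sub>R k)" using tk \<delta>C by (simp add: mult_left_mono)
    also have "\<dots> \<le> norm (x + t *\<^sub>R k) + norm x" using norm_triangle_ineq4[of "x + t *\<^sub>R k" x] by simp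
    finally show ?thesis by (simp add: g_def tk)
  qed
  have Sne: "S \<noteq> {}" using False by (auto simp: S_def)
  have le: "p x \<le> g x s" if "s \<in> S" for x s
    unfolding p_def using that low by (intro cINF_lower bdd_belowI2[where m="- norm x"])
  have ge: "m \<le> p x" if "\<And>s. s \<in> S \<Longrightarrow> m \<le> g x s" for m x
    unfolding p_def using that Sne by (intro cINF_greatest)
  obtain k0 where k0: "k0 \<in> C" using False by blast
  have p0: "p 0 = 0"
  proof (rule antisym)
    show "p 0 \<le> 0" using le[of "(0, k0)" 0] k0 by (simp add: S_def g_def)
    show "0 \<le> p 0" using ge[of 0 0] low[of _ 0] by simp
  qed
  have sub: "p (x + y) \<le> p x + p y" for x y
  proof -
    have "p (x + y) \<le> g x s + g y s'" if ss: "s \<in> S" "s' \<in> S" for s s'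
    proof -
      obtain t k t' k' where tk: "s = (t, k)" "t \<ge> 0" "k \<in> C" "s' = (t', k')" "t' \<ge> 0" "k' \<in> C"
        using ss by (auto simp: S_def)
      show ?thesis
      proof (cases "t + t' = 0")
        case True
        then have "t = 0" "t' = 0" using tk by auto
        then show ?thesis
          using le[of "(0, k)" "x + y"] tk norm_triangle_ineq[of x y] by (auto simp: S_def g_def)
      next
        case F: False
        \<comment> \<open>Normalised weights turn \<open>t *\<^sub>R k + t' *\<^sub>R k'\<close>
          into a multiple of one point of \<open>C\<close>; this is where convexity yields
          subadditivity.\<close>
        define k'' where "k'' = (t / (t + t')) *\<^sub>R k + (t' / (t + t')) *\<^sub>R k'"
        have k'': "k'' \<in> C" unfolding k''_def using F tk C(1)
          by (intro convexD) (auto simp: add_divide_distrib[symmetric])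
        have "(t + t') *\<^sub>R k'' = t *\<^sub>R k + t' *\<^sub>R k'" using F by (simp add: k''_def scaleR_add_right)
        then have "x + y + (t + t') *\<^sub>R k'' = (x + t *\<^sub>R k) + (y + t' *\<^sub>R k')" by simp
        then have "norm (x + y + (t + t') *\<^sub>R k'') \<le> norm (x + t *\<^sub>R k) + norm (y + t' *\<^sub>R k')"
          by (metis norm_triangle_ineq)
        then show ?thesis
          using le[of "(t + t', k'')" "x + y"] tk k'' by (auto simp: S_def g_def algebra_simps)
      qed
    qed
    then have "p (x + y) - g x s \<le> p y" if "s \<in> S" for s
      using that by (intro ge) (simp add: algebra_simps)
    then have "p (x + y) - p y \<le> p x" by (intro ge) (simp add: algebra_simps)
    then show ?thesis by simp
  qed
  have hom: "p (r *\<^sub>R x) \<le> r * p x" if r: "r > 0" for r x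
  proof -
    have "p (r *\<^sub>R x) / r \<le> g x s" if s: "s \<in> S" for s
    proof -
      obtain t k where tk: "s = (t, k)" "t \<ge> 0" "k \<in> C" using s by (auto simp: S_def)
      have "norm (r *\<^sub>R x + (r * t) *\<^sub>R k) = r * norm (x + t *\<^sub>R k)"
        using r by (metis abs_of_pos norm_scaleR scaleR_add_right scaleR_scaleR)
      then have "p (r *\<^sub>R x) \<le> r * g x s"
        using le[of "(r * t, k)" "r *\<^sub>R x"] tk r by (auto simp: S_def g_def algebra_simps)
      then show ?thesis using r by (simp add: field_simps)
    qed
    then have "p (r *\<^sub>R x) / r \<le> p x" by (intro ge)
    then show ?thesis using r by (simp add: field_simps)
  qed
  have "sublinear p" using p0 sub hom unfolding sublinear_def by blast
  from Hahn_Banach_sublinear[OF this] obtain f where f: "linear f" "f \<le> p" .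
  have fC: "f k \<ge> \<delta>" if "k \<in> C" for k
  proof -
    have "f (- k) \<le> p (- k)" using f(2) by (simp add: le_fun_def)
    also have "\<dots> \<le> - \<delta>" using le[of "(1, k)" "- k"] that by (auto simp: S_def g_def)
    finally show ?thesis using linear_neg[OF f(1)] by simp
  qed
  show ?thesis by (rule that[OF f(1) \<delta> fC])
qed

text \<open>Each functional lowers the dimension by at most one, so by induction the common kernel
  lies in no finitely generated span, in particular not in the zero space.\<close>

lemma finite_linear_common_kernel:
  fixes \<Phi> :: "('a::real_vector \<Rightarrow> real) set"
  assumes "finite \<Phi>" "\<And>f. f \<in> \<Phi> \<Longrightarrow> linear f" and inf: "\<nexists>B::'a set. finite B \<and> span B = UNIV"
  shows "\<exists>x. x \<noteq> 0 \<and> (\<forall>f\<in>\<Phi>. f x = 0)"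
proof -
  have "\<nexists>B. finite B \<and> {x. \<forall>f\<in>\<Phi>. f x = 0} \<subseteq> span B"
    using assms(1,2)
  proof (induction \<Phi>)
    case empty
    then show ?case using inf by auto
  next
    case (insert f \<Phi>)
    let ?K = "{x. \<forall>f\<in>\<Phi>. f x = 0}"
    have lin: "\<And>g. g \<in> \<Phi> \<Longrightarrow> linear g" "linear f" using insert by auto
    show ?case
    proof
      assume "\<exists>B. finite B \<and> {x. \<forall>g\<in>insert f \<Phi>. g x = 0} \<subseteq> span B"
      then obtain B where B: "finite B" "{x. \<forall>g\<in>insert f \<Phi>. g x = 0} \<subseteq> span B" by blast
      have "\<exists>B'. finite B' \<and> ?K \<subseteq> span B'"
      proof (cases "\<exists>w\<in>?K. f w \<noteq> 0")
        case True
        then obtain w where w: "w \<in> ?K" "f w \<noteq> 0" by blast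
        have "x \<in> span (insert w B)" if x: "x \<in> ?K" for x
        proof -
          have "f (x - (f x / f w) *\<^sub>R w) = 0"
            using w(2) by (simp add: linear_diff[OF lin(2)] linear_scale[OF lin(2)])
          moreover have "g (x - (f x / f w) *\<^sub>R w) = 0" if "g \<in> \<Phi>" for g
          proof -
            have "g x = 0" "g w = 0" using x w(1) that by blast+
            then show ?thesis by (simp add: linear_diff[OF lin(1)[OF that]] linear_scale[OF lin(1)[OF that]])
          qed
          ultimately have "x - (f x / f w) *\<^sub>R w \<in> span B"
            using B(2) by blast
          then have "x - (f x / f w) *\<^sub>R w + (f x / f w) *\<^sub>R w \<in> span (insert w B)"
            using span_mono[of B "insert w B"] by (intro span_add span_scale) (auto intro: span_base)
          then show ?thesis by simp
        qed
        then show ?thesis using B(1) by (intro exI[of _ "insert w B"]) auto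
      next
        case False
        then show ?thesis using B by blast
      qed
      then show False using insert.IH lin by blast
    qed
  qed
  then have "\<not> {x. \<forall>f\<in>\<Phi>. f x = 0} \<subseteq> span {}" by blast
  then obtain x where "\<forall>f\<in>\<Phi>. f x = 0" "x \<noteq> 0" by auto
  then show ?thesis by blast
qed

section \<open>Ultrafilters\<close>

text \<open>A minimal proper filter below \<open>F0\<close> decides every \<open>P\<close>: unless
  the negation of \<open>P\<close> holds eventually, restricting to \<open>P\<close> leaves the
  filter proper and hence, by minimality, unchanged.\<close>

lemma exists_ultrafilter:
  fixes F0 :: "'a filter"
  assumes "F0 \<noteq> bot"
  shows "\<exists>F\<le>F0. F \<noteq> bot \<and> (\<forall>P. eventually P F \<or> eventually (\<lambda>x. \<not> P x) F)"
proof -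
  define A where "A = {F. F \<noteq> bot \<and> F \<le> F0}"
  have "\<exists>m\<in>A. \<forall>a\<in>A. a \<le> m \<longrightarrow> a = m"
  proof (rule predicate_Zorn[where P="\<lambda>a b. b \<le> a"])
    show "partial_order_on A (relation_of (\<lambda>a b. b \<le> a) A)"
      by (rule partial_order_on_relation_ofI) auto
    fix C assume C: "C \<in> Chains (relation_of (\<lambda>a b. b \<le> a) A)"
    show "\<exists>u\<in>A. \<forall>a\<in>C. u \<le> a"
    proof (cases "C = {}")
      case True
      then show ?thesis using assms by (auto simp: A_def)
    next
      case False
      have CA: "q \<in> A" if "q \<in> C" for q
        using C that by (auto simp: Chains_def relation_of_def)
      have ch: "q \<le> q' \<or> q' \<le> q" if "q \<in> C" "q' \<in> C" for q q'
        using C that by (auto simp: Chains_def relation_of_def)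
      \<comment> \<open>Along a chain, whatever holds eventually for the infimum already does so for
        one member; hence the infimum stays proper.\<close>
      have ev: "eventually P (Inf C) \<longleftrightarrow> (\<exists>b\<in>C. eventually P b)" for P
        using ch by (intro eventually_Inf_base False) (metis inf.absorb1 inf.absorb2 order_refl)
      have "Inf C \<noteq> bot"
        using CA by (auto simp: trivial_limit_def ev A_def)
      moreover have "Inf C \<le> F0"
        using False CA by (auto simp: A_def intro: Inf_lower2)
      ultimately show ?thesis by (auto simp: A_def intro!: bexI[of _ "Inf C"] Inf_lower)
    qed
  qed
  then obtain F where F: "F \<noteq> bot" "F \<le> F0" and min: "\<And>G. G \<noteq> bot \<Longrightarrow> G \<le> F \<Longrightarrow> G = F"
    by (auto simp: A_def intro: order_trans)
  have "eventually P F \<or> eventually (\<lambda>x. \<not> P x) F" for P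
  proof (rule disjCI)
    assume "\<not> eventually (\<lambda>x. \<not> P x) F"
    then have "inf F (principal {x. P x}) \<noteq> bot"
      by (simp add: trivial_limit_def eventually_inf_principal)
    then have "inf F (principal {x. P x}) = F" by (intro min) auto
    moreover have "eventually P (inf F (principal {x. P x}))"
      by (simp add: eventually_inf_principal)
    ultimately show "eventually P F" by simp
  qed
  then show ?thesis using F by blast
qed

text \<open>The sphere and the complements of all sets whose closed convex hull misses
  \<open>0\<close> generate a proper filter: finitely many such sets are separated from
  \<open>0\<close> by functionals, and a unit vector in the common kernel avoids them all. Any
  ultrafilter below it works.\<close>

lemma exists_weakly_null_ultrafilter:
  assumes inf: "\<nexists>B::'a::real_normed_vector set. finite B \<and> span B = UNIV"
  shows "\<exists>U::'a filter. U \<noteq> bot \<and> (\<forall>P. eventually P U \<or> eventually (\<lambda>x. \<not> P x) U) \<and>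
    eventually (\<lambda>y. norm y = 1) U \<and> (\<forall>P. eventually P U \<longrightarrow> 0 \<in> closure (convex hull {y. P y}))"
proof -
  define \<S> where "\<S> = {S::'a set. 0 \<notin> closure (convex hull S)}"
  define F0 where "F0 = inf (INF S\<in>\<S>. principal (- S)) (principal (sphere 0 1))"
  have "F0 \<noteq> bot"
  proof
    assume "F0 = bot"
    then have "eventually (\<lambda>x. x \<notin> sphere (0::'a) 1) (INF S\<in>\<S>. principal (- S))"
      by (simp add: F0_def trivial_limit_def eventually_inf_principal)
    then obtain X where X: "X \<subseteq> \<S>" "finite X"
      and ev: "eventually (\<lambda>x. x \<notin> sphere (0::'a) 1) (INF S\<in>X. principal (- S))"
      using eventually_INF[THEN iffD1] by blast
    have cover: "x \<notin> sphere 0 1" if "\<forall>S\<in>X. x \<notin> S" for x :: 'a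
    proof -
      have "eventually (\<lambda>x. x \<notin> sphere (0::'a) 1) (principal (\<Inter>S\<in>X. - S))"
        using ev unfolding INF_principal_finite[OF X(2)] .
      then show ?thesis using that unfolding eventually_principal by blast
    qed
    have "\<forall>S\<in>X. \<exists>f::'a \<Rightarrow> real. linear f \<and> (\<exists>\<delta>>0. \<forall>x\<in>convex hull S. f x \<ge> \<delta>)"
    proof
      fix S assume "S \<in> X"
      then have "0 \<notin> closure (convex hull S)" using X by (auto simp: \<S>_def)
      then show "\<exists>f::'a \<Rightarrow> real. linear f \<and> (\<exists>\<delta>>0. \<forall>x\<in>convex hull S. f x \<ge> \<delta>)"
        by (rule convex_separate_0[OF convex_convex_hull]) blast
    qed
    then obtain f where f: "\<And>S. S \<in> X \<Longrightarrow> linear (f S :: 'a \<Rightarrow> real)"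
        "\<And>S. S \<in> X \<Longrightarrow> \<exists>\<delta>>0. \<forall>x\<in>convex hull S. f S x \<ge> \<delta>"
      by metis
    have fin: "finite (f ` X)" and lin: "\<And>g. g \<in> f ` X \<Longrightarrow> linear g" using X(2) f(1) by auto
    from finite_linear_common_kernel[OF fin lin inf]
    obtain x where x: "x \<noteq> 0" "\<And>g. g \<in> f ` X \<Longrightarrow> g x = 0" by auto
    have "x /\<^sub>R norm x \<notin> S" if "S \<in> X" for S
    proof
      assume "x /\<^sub>R norm x \<in> S"
      then have "x /\<^sub>R norm x \<in> convex hull S" by (rule hull_inc)
      moreover have "f S (x /\<^sub>R norm x) = 0" using x(2)[of "f S"] f(1) that by (simp add: linear_scale)
      ultimately show False using f(2)[OF that] by fastforce
    qed
    then show False using cover[of "x /\<^sub>R norm x"] x(1) by auto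
  qed
  from exists_ultrafilter[OF this] obtain U
    where U: "U \<noteq> bot" "U \<le> F0" "\<And>P. eventually P U \<or> eventually (\<lambda>x. \<not> P x) U"
    by auto
  have "eventually (\<lambda>y. y \<in> sphere 0 1) F0"
    by (simp add: F0_def eventually_inf_principal)
  then have "eventually (\<lambda>y. norm y = 1) U" using U(2) by (auto simp: filter_leD)
  moreover have "0 \<in> closure (convex hull {y. P y})" if P: "eventually P U" for P
  proof (rule ccontr)
    assume "0 \<notin> closure (convex hull {y. P y})"
    then have "{y. P y} \<in> \<S>" by (simp add: \<S>_def)
    then have "F0 \<le> principal (- {y. P y})"
      unfolding F0_def by (intro le_infI1 INF_lower)
    then have "eventually (\<lambda>y. \<not> P y) U"
      using U(2) by (auto simp: le_principal dest: filter_leD)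
    then have "eventually (\<lambda>y. False) U" using P by eventually_elim auto
    then show False using U(1) by (simp add: trivial_limit_def)
  qed
  ultimately show ?thesis using U(1,3) by blast
qed


section \<open>Separation up to rotation\<close>

definition torally_separated :: "real \<Rightarrow> (nat \<Rightarrow> 'a::complex_normed_vector) \<Rightarrow> bool" where
  "torally_separated d x \<longleftrightarrow> (\<forall>n m. n \<noteq> m \<longrightarrow> (\<forall>\<theta>. cmod \<theta> = 1 \<longrightarrow> d \<le> norm (x n - \<theta> *\<^sub>C x m)))"

lemma scaleC_scaleR_commute: "a *\<^sub>C (r *\<^sub>R x) = r *\<^sub>R (a *\<^sub>C (x :: 'a::complex_normed_vector))"
  by (simp add: scaleR_scaleC scaleC_scaleC mult.commute)

lemma bounded_linear_scaleC: "bounded_linear (\<lambda>x::'a::complex_normed_vector. a *\<^sub>C x)"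
  by (rule bounded_linear_intro[where K="cmod a"])
    (simp_all add: scaleC_add_right scaleC_scaleR_commute norm_scaleC mult.commute)

text \<open>The norm is convex along the ray of points \<open>a - s *\<^sub>R b\<close>; being no
  larger at \<open>s = 0\<close> than at \<open>s = 1\<close>, it cannot drop beyond
  \<open>s = 1\<close>.\<close>

lemma norm_diff_le_norm_diff_scaleR:
  fixes a b :: "'a::real_normed_vector"
  assumes "norm a \<le> norm (a - b)" "t \<ge> 1"
  shows "norm (a - b) \<le> norm (a - t *\<^sub>R b)"
proof -
  have "t *\<^sub>R (a - b) = (t - 1) *\<^sub>R a + (a - t *\<^sub>R b)" by (simp add: algebra_simps)
  then have "t * norm (a - b) \<le> (t - 1) * norm a + norm (a - t *\<^sub>R b)"
    using assms(2) norm_triangle_ineq[of "(t - 1) *\<^sub>R a" "a - t *\<^sub>R b"]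
    by (metis abs_of_nonneg diff_ge_0_iff_ge norm_scaleR order_trans zero_le_one)
  moreover have "(t - 1) * norm a \<le> (t - 1) * norm (a - b)"
    using assms by (intro mult_left_mono) auto
  ultimately show ?thesis by (simp add: algebra_simps)
qed

text \<open>After scaling into the unit ball, the two vectors are stretched to length one in turn.
  Both factors are at least \<open>1\<close>, so \<open>norm_diff_le_norm_diff_scaleR\<close>
  applies twice.\<close>

lemma norm_sgn_diff_ge:
  fixes a b :: "'a::real_normed_vector"
  assumes "R > 0" "\<epsilon> > 0" "norm a \<le> R" "norm b \<le> R" "norm (a - b) \<ge> R * (1 + \<epsilon>)"
  shows "norm (sgn a - sgn b) \<ge> 1 + \<epsilon>"
proof -
  have "R < R * (1 + \<epsilon>)" using assms by simp
  then have "norm b \<noteq> norm (a - b)" "norm a \<noteq> norm (a - b)" using assms by linarith+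
  then have nz: "a \<noteq> 0" "b \<noteq> 0" by auto
  define A B where "A = a /\<^sub>R R" and "B = b /\<^sub>R R"
  have A: "norm A \<le> 1" "norm B \<le> 1" using assms by (auto simp: A_def B_def field_simps)
  have "norm (A - B) = norm (a - b) / R"
    using assms(1) by (simp add: A_def B_def divide_inverse flip: scaleR_diff_right)
  then have AB: "norm (A - B) \<ge> 1 + \<epsilon>"
    using assms(1,5) by (simp only: pos_le_divide_eq mult.commute)
  have s: "sgn a = (R / norm a) *\<^sub>R A" "sgn b = (R / norm b) *\<^sub>R B"
    using assms(1) by (auto simp: A_def B_def sgn_div_norm field_simps)
  have t: "R / norm a \<ge> 1" "R / norm b \<ge> 1" using assms nz by auto
  have 1: "1 + \<epsilon> \<le> norm (A - sgn b)"
    using norm_diff_le_norm_diff_scaleR[of A B "R / norm b"] A AB t assms(2) s(2) by simp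
  have "norm (sgn b) = 1" using nz by (simp add: norm_sgn)
  then have "norm (sgn b - A) \<le> norm (sgn b - (R / norm a) *\<^sub>R A)"
    using 1 t(1) assms(2) by (intro norm_diff_le_norm_diff_scaleR) (auto simp: norm_minus_commute)
  then show ?thesis using 1 s(1) by (simp add: norm_minus_commute)
qed

lemma torally_separated_normalize:
  fixes x :: "nat \<Rightarrow> 'a::complex_normed_vector"
  assumes "R > 0" "\<epsilon> > 0" "\<And>n. norm (x n) \<le> R" "torally_separated (R * (1 + \<epsilon>)) x"
  shows "\<exists>u::nat \<Rightarrow> 'a. (\<forall>n. norm (u n) = 1) \<and> torally_separated (1 + \<epsilon>) u"
proof (intro exI[of _ "\<lambda>n. sgn (x n)"] conjI allI)
  fix n
  \<comment> \<open>Being further than \<open>R\<close> from a vector of norm at most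
    \<open>R\<close> forces \<open>x n\<close> to be nonzero.\<close>
  have "R * (1 + \<epsilon>) \<le> norm (x n - 1 *\<^sub>C x (Suc n))"
    using assms(4) unfolding torally_separated_def by (metis n_not_Suc_n norm_one)
  also have "\<dots> \<le> norm (x n) + R"
    using norm_triangle_ineq4[of "x n" "x (Suc n)"] assms(3)[of "Suc n"] by (simp add: scaleC_one)
  finally have "0 < norm (x n)" using assms(1,2) using mult_pos_pos[OF assms(1,2)] by (simp only: distrib_left mult_1_right)
  then show "norm (sgn (x n)) = 1" by (simp add: norm_sgn)
next
  have "1 + \<epsilon> \<le> norm (sgn (x n) - \<theta> *\<^sub>C sgn (x m))" if "n \<noteq> m" "cmod \<theta> = 1" for n m \<theta>
  proof -
    have "sgn (\<theta> *\<^sub>C x m) = \<theta> *\<^sub>C sgn (x m)"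
      using that by (simp add: sgn_div_norm norm_scaleC scaleC_scaleR_commute)
    moreover have "1 + \<epsilon> \<le> norm (sgn (x n) - sgn (\<theta> *\<^sub>C x m))"
      using assms that by (intro norm_sgn_diff_ge[of R]) (auto simp: norm_scaleC torally_separated_def)
    ultimately show ?thesis by simp
  qed
  then show "torally_separated (1 + \<epsilon>) (\<lambda>n. sgn (x n))" by (simp add: torally_separated_def)
qed

text \<open>Factoring out \<open>- \<theta>\<close> exchanges the two vectors and inverts \<theta>,
  so it suffices to compare each vector with its predecessors.\<close>

lemma torally_separatedI:
  fixes x :: "nat \<Rightarrow> 'a::complex_normed_vector"
  assumes "\<And>n m \<theta>. m < n \<Longrightarrow> cmod \<theta> = 1 \<Longrightarrow> d \<le> norm (x n - \<theta> *\<^sub>C x m)"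
  shows "torally_separated d x"
  unfolding torally_separated_def
proof (intro allI impI)
  fix n m :: nat and \<theta> assume nm: "n \<noteq> m" and \<theta>: "cmod \<theta> = 1"
  show "d \<le> norm (x n - \<theta> *\<^sub>C x m)"
  proof (cases "m < n")
    case True
    then show ?thesis using assms \<theta> by blast
  next
    case False
    have "\<theta> \<noteq> 0" using \<theta> by auto
    then have "x n - \<theta> *\<^sub>C x m = (- \<theta>) *\<^sub>C (x m - inverse \<theta> *\<^sub>C x n)"
      by (simp add: complex_vector.scale_right_diff_distrib scaleC_scaleC scaleC_one)
    then have "norm (x n - \<theta> *\<^sub>C x m) = norm (x m - inverse \<theta> *\<^sub>C x n)"
      using \<theta> by (simp add: norm_scaleC)
    then show ?thesis using assms[of n m "inverse \<theta>"] False nm \<theta> by (simp add: norm_inverse)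
  qed
qed

section \<open>Finite covers in the absence of separated sequences\<close>

definition no_torally_separated :: "'a::complex_normed_vector itself \<Rightarrow> bool" where
  "no_torally_separated _ \<longleftrightarrow>
    \<not> (\<exists>\<epsilon>>0. \<exists>x::nat \<Rightarrow> 'a. (\<forall>n. norm (x n) = 1) \<and> torally_separated (1 + \<epsilon>) x)"

text \<open>Otherwise points of \<open>T\<close> could be chosen one after another, each at distance
  at least \<open>R'\<close> from all rotations of its predecessors; normalised, they would be
  separated by \<open>R' / R > 1\<close>.\<close>

lemma no_torally_separated_cover:
  fixes T :: "'a::complex_normed_vector set"
  assumes H: "no_torally_separated TYPE('a)"
    and R: "0 < R" "R < R'" and T: "T \<subseteq> cball 0 R" "T \<noteq> {}"
  shows "\<exists>V\<subseteq>T. finite V \<and> (\<forall>x\<in>T. \<exists>v\<in>V. \<exists>\<theta>. cmod \<theta> = 1 \<and> norm (x - \<theta> *\<^sub>C v) < R')"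
proof (rule ccontr)
  assume "\<not> ?thesis"
  then have no_cover: "\<not> (\<forall>x\<in>T. \<exists>v\<in>V. \<exists>\<theta>. cmod \<theta> = 1 \<and> norm (x - \<theta> *\<^sub>C v) < R')"
    if "V \<subseteq> T" "finite V" for V using that by simp
  have far: "\<exists>x\<in>T. \<forall>v\<in>V. \<forall>\<theta>. cmod \<theta> = 1 \<longrightarrow> R' \<le> norm (x - \<theta> *\<^sub>C v)" if "V \<subseteq> T" "finite V" for V
    using no_cover[OF that] by (auto simp: not_less)
  have "\<exists>f::nat \<Rightarrow> 'a. \<forall>n. f n \<in> T \<and> (\<forall>m<n. \<forall>\<theta>. cmod \<theta> = 1 \<longrightarrow> R' \<le> norm (f n - \<theta> *\<^sub>C f m))"
  proof (rule dependent_wellorder_choice)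
    fix n and f :: "nat \<Rightarrow> 'a"
    assume "\<And>y. y < n \<Longrightarrow> f y \<in> T \<and> (\<forall>m<y. \<forall>\<theta>. cmod \<theta> = 1 \<longrightarrow> R' \<le> norm (f y - \<theta> *\<^sub>C f m))"
    then have "f ` {..<n} \<subseteq> T" by auto
    then show "\<exists>r. r \<in> T \<and> (\<forall>m<n. \<forall>\<theta>. cmod \<theta> = 1 \<longrightarrow> R' \<le> norm (r - \<theta> *\<^sub>C f m))"
      using far[of "f ` {..<n}"] by auto
  qed simp
  then obtain f :: "nat \<Rightarrow> 'a" where f0:
    "\<forall>n. f n \<in> T \<and> (\<forall>m<n. \<forall>\<theta>. cmod \<theta> = 1 \<longrightarrow> R' \<le> norm (f n - \<theta> *\<^sub>C f m))" ..
  then have f: "\<And>n. f n \<in> T" "\<And>n m \<theta>. m < n \<Longrightarrow> cmod \<theta> = 1 \<Longrightarrow> R' \<le> norm (f n - \<theta> *\<^sub>C f m)"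
    by simp_all
  define \<epsilon> where "\<epsilon> = R' / R - 1"
  have \<epsilon>: "\<epsilon> > 0" "R * (1 + \<epsilon>) = R'" using R by (auto simp: \<epsilon>_def field_simps)
  have sep: "torally_separated (R * (1 + \<epsilon>)) f"
    using f(2) \<epsilon>(2) by (intro torally_separatedI) simp
  have "norm (f n) \<le> R" for n using f(1)[of n] T(1) by auto
  from torally_separated_normalize[OF R(1) \<epsilon>(1) this sep]
  have "\<exists>u::nat \<Rightarrow> 'a. (\<forall>n. norm (u n) = 1) \<and> torally_separated (1 + \<epsilon>) u" .
  then show False using H \<epsilon>(1) unfolding no_torally_separated_def by blast
qed

lemma finite_net_circle:
  assumes "\<kappa> > 0"
  shows "\<exists>A. finite A \<and> A \<subseteq> sphere (0::complex) 1 \<and> (\<forall>c. cmod c = 1 \<longrightarrow> (\<exists>a\<in>A. cmod (c - a) < \<kappa>))"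
proof -
  have "sphere (0::complex) 1 \<subseteq> (\<Union>a\<in>sphere 0 1. ball a \<kappa>)" using assms by force
  then obtain A where "finite A" "A \<subseteq> sphere (0::complex) 1" "sphere 0 1 \<subseteq> (\<Union>a\<in>A. ball a \<kappa>)"
    by (rule compactE_image[OF compact_sphere open_ball])
  then show ?thesis
    by (intro exI[of _ A]) (auto simp: dist_norm norm_minus_commute subset_iff)
qed

text \<open>A finite net of the circle replaces the rotations in the cover, and invariance of
  \<open>T\<close> keeps the rotated centres in \<open>T\<close>. The sign in \<open>- a\<close>
  turns a small difference into a small sum.\<close>

lemma no_torally_separated_translates:
  fixes T :: "'a::complex_normed_vector set"
  assumes H: "no_torally_separated TYPE('a)"
    and R: "0 < R" "R < R'" and T: "T \<subseteq> cball 0 R" "T \<noteq> {}"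
    and rot: "\<And>x \<theta>. x \<in> T \<Longrightarrow> cmod \<theta> = 1 \<Longrightarrow> \<theta> *\<^sub>C x \<in> T"
  shows "\<exists>V\<subseteq>T. finite V \<and> V \<noteq> {} \<and> (\<forall>x\<in>T. \<exists>v\<in>V. norm (v + x) \<le> R')"
proof -
  \<comment> \<open>The midpoint reserves \<open>R' - R''\<close> for the error of replacing
    \<theta> by a point of the net.\<close>
  define R'' where "R'' = (R + R') / 2"
  have R'': "R < R''" "R'' < R'" using R by (auto simp: R''_def)
  obtain V where V: "V \<subseteq> T" "finite V"
    "\<And>x. x \<in> T \<Longrightarrow> \<exists>v\<in>V. \<exists>\<theta>. cmod \<theta> = 1 \<and> norm (x - \<theta> *\<^sub>C v) < R''"
    using no_torally_separated_cover[OF H R(1) R''(1) T] by blast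
  have pos: "(R' - R'') / R > 0" using R R'' by simp
  then obtain A where A: "finite A" "A \<subseteq> sphere (0::complex) 1"
    "\<And>c. cmod c = 1 \<Longrightarrow> \<exists>a\<in>A. cmod (c - a) < (R' - R'') / R"
    using finite_net_circle by meson
  let ?V = "(\<lambda>(a, v). (- a) *\<^sub>C v) ` (A \<times> V)"
  have "?V \<subseteq> T"
  proof clarify
    fix a v assume "a \<in> A" "v \<in> V"
    then show "(- a) *\<^sub>C v \<in> T" using A(2) V(1) by (intro rot) auto
  qed
  moreover have near: "\<exists>w\<in>?V. norm (w + x) \<le> R'" if x: "x \<in> T" for x
  proof -
    obtain v \<theta> where v: "v \<in> V" "cmod \<theta> = 1" "norm (x - \<theta> *\<^sub>C v) < R''" using V(3)[OF x] by blast
    obtain a where a: "a \<in> A" "cmod (\<theta> - a) < (R' - R'') / R" using A(3)[OF v(2)] by blast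
    have "norm ((\<theta> - a) *\<^sub>C v) \<le> (R' - R'') / R * R"
      unfolding norm_scaleC using v(1) V(1) T(1) a(2) pos by (intro mult_mono) auto
    then have "norm ((\<theta> - a) *\<^sub>C v) \<le> R' - R''" using R by simp
    moreover have "(- a) *\<^sub>C v + x = (x - \<theta> *\<^sub>C v) + (\<theta> - a) *\<^sub>C v"
      by (simp add: complex_vector.scale_left_diff_distrib)
    ultimately have "norm ((- a) *\<^sub>C v + x) \<le> R'"
      using v(3) norm_triangle_ineq[of "x - \<theta> *\<^sub>C v" "(\<theta> - a) *\<^sub>C v"]
      by (smt (verit))
    moreover have "(- a) *\<^sub>C v \<in> ?V" using a(1) v(1) by (intro image_eqI[of _ _ "(a, v)"]) auto
    ultimately show ?thesis by blast
  qed
  moreover have "?V \<noteq> {}" using near T(2) by blast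
  moreover have "finite ?V" using A(1) V(2) by simp
  ultimately show ?thesis by blast
qed

section \<open>The generic game\<close>

text \<open>The last condition says that \<open>0\<close> is a weak limit of \<open>U\<close>.\<close>

locale weakly_null_ultrafilter =
  fixes U :: "'a::complex_normed_vector filter"
  assumes nontrivial: "U \<noteq> bot"
    and ultra: "eventually P U \<or> eventually (\<lambda>y. \<not> P y) U"
    and norm_one: "eventually (\<lambda>y. norm y = 1) U"
    and zero_in_closure: "eventually P U \<Longrightarrow> 0 \<in> closure (convex hull {y. P y})"
begin

text \<open>The \<open>y\<close> with \<open>x + c *\<^sub>C y \<in> C\<close> form a closed convex
  set; being large for \<open>U\<close>, it contains \<open>0\<close>. For balls this is weak lower
  semicontinuity of the norm.\<close>

lemma eventually_in_closed_convex:
  assumes ev: "eventually (\<lambda>y. x + c *\<^sub>C y \<in> C) U" and C: "closed C" "convex C"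
  shows "x \<in> C"
proof -
  let ?D = "{y. x + c *\<^sub>C y \<in> C}"
  have "closed ((\<lambda>y. x + c *\<^sub>C y) -` C)"
    by (intro closed_vimage C continuous_intros bounded_linear.continuous_on[OF bounded_linear_scaleC])
  then have "closed ?D" by (simp add: vimage_def)
  moreover have "convex ?D"
  proof (rule convexI)
    fix y z and u v :: real
    assume yz: "y \<in> ?D" "z \<in> ?D" and uv: "0 \<le> u" "0 \<le> v" "u + v = 1"
    have "u *\<^sub>R (x + c *\<^sub>C y) + v *\<^sub>R (x + c *\<^sub>C z) = (u + v) *\<^sub>R x + c *\<^sub>C (u *\<^sub>R y + v *\<^sub>R z)"
      by (simp only: scaleR_add_left scaleR_add_right scaleC_add_right scaleC_scaleR_commute add_ac)
    moreover have "u *\<^sub>R (x + c *\<^sub>C y) + v *\<^sub>R (x + c *\<^sub>C z) \<in> C"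
      using C(2) yz uv by (intro convexD) auto
    ultimately show "u *\<^sub>R y + v *\<^sub>R z \<in> ?D" using uv by simp
  qed
  ultimately have "closure (convex hull ?D) \<subseteq> ?D"
    by (simp add: hull_same)
  then show ?thesis using zero_in_closure[OF ev] by auto
qed

lemma eventually_norm_le:
  "eventually (\<lambda>y. norm (x + c *\<^sub>C y) \<le> r) U \<Longrightarrow> norm x \<le> r"
  using eventually_in_closed_convex[of x c "cball 0 r"] by auto

lemma not_eventually: "\<not> eventually P U \<longleftrightarrow> eventually (\<lambda>y. \<not> P y) U"
proof
  show "\<not> eventually P U \<Longrightarrow> eventually (\<lambda>y. \<not> P y) U" using ultra[of P] by blast
  show "\<not> eventually P U" if "eventually (\<lambda>y. \<not> P y) U"
  proof
    assume "eventually P U"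
    with that have "eventually (\<lambda>y. False) U" by eventually_elim simp
    then show False using nontrivial by (simp add: trivial_limit_def)
  qed
qed

lemma eventually_bex_finite:
  assumes "finite V" "eventually (\<lambda>y. \<exists>v\<in>V. P v y) U"
  shows "\<exists>v\<in>V. eventually (P v) U"
proof (rule ccontr)
  assume "\<not> ?thesis"
  then have "\<forall>v\<in>V. eventually (\<lambda>y. \<not> P v y) U" by (simp add: not_eventually)
  then have "eventually (\<lambda>y. \<forall>v\<in>V. \<not> P v y) U" by (rule eventually_ball_finite[OF assms(1)])
  then have "\<not> eventually (\<lambda>y. \<exists>v\<in>V. P v y) U" by (simp add: not_eventually)
  then show False using assms(2) by blast
qed

text \<open>\<open>lose L r\<close> are the positions from which every move exceeds the radius \<open>r\<close> or leads into \<open>L r\<close>. Its transfinite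
  iterates replace ordinal ranks; all radii are iterated simultaneously, so that stages
  for different radii can be compared.\<close>

definition lose :: "(real \<Rightarrow> 'a set) \<Rightarrow> real \<Rightarrow> 'a set" where
  "lose L r = {s. \<forall>c. cmod c = 1 \<longrightarrow>
    eventually (\<lambda>y. r < norm (s + c *\<^sub>C y) \<or> s + c *\<^sub>C y \<in> L r) U}"

lemma mono_lose: "monotone (\<le>) (\<le>) lose"
  by (rule monotoneI) (force simp: lose_def le_fun_def elim: eventually_mono)

lemma not_lose_iff:
  "s \<notin> lose L r \<longleftrightarrow> (\<exists>c. cmod c = 1 \<and> eventually (\<lambda>y. norm (s + c *\<^sub>C y) \<le> r \<and> s + c *\<^sub>C y \<notin> L r) U)"
  by (simp add: lose_def not_eventually not_less)

text \<open>A move with \<open>c\<close> from \<open>\<theta> *\<^sub>C x\<close> is the rotation by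
  \<theta> of the move with \<open>c / \<theta>\<close> from \<open>x\<close>. The covering argument
  needs this invariance.\<close>

lemma lose_rotate:
  assumes "D \<in> Complete_Partial_Order.iterates lose" "cmod \<theta> = 1" "x \<in> D r"
  shows "\<theta> *\<^sub>C x \<in> D r"
  using assms
proof (induction arbitrary: x rule: iterates.induct)
  case (step D)
  show ?case unfolding lose_def mem_Collect_eq
  proof (intro allI impI)
    fix c :: complex assume c: "cmod c = 1"
    have \<theta>: "\<theta> \<noteq> 0" using step.prems by auto
    have "cmod (c / \<theta>) = 1" using c step.prems by (simp add: norm_divide)
    then have "eventually (\<lambda>y. r < norm (x + (c / \<theta>) *\<^sub>C y) \<or> x + (c / \<theta>) *\<^sub>C y \<in> D r) U"
      using step.prems by (simp add: lose_def)
    then show "eventually (\<lambda>y. r < norm (\<theta> *\<^sub>C x + c *\<^sub>C y) \<or> \<theta> *\<^sub>C x + c *\<^sub>C y \<in> D r) U"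
    proof eventually_elim
      case (elim y)
      have eq: "\<theta> *\<^sub>C x + c *\<^sub>C y = \<theta> *\<^sub>C (x + (c / \<theta>) *\<^sub>C y)"
        using \<theta> by (simp add: scaleC_add_right scaleC_scaleC)
      show ?case using elim step.IH[OF step.prems(1)] step.prems(1)
        unfolding eq norm_scaleC by auto
    qed
  qed
next
  case (Sup M)
  then show ?case by auto
qed

text \<open>The point \<open>v\<close> depends on the position, but as \<open>V\<close> is finite the same one serves \<open>U\<close>-almost all successors of
  \<open>x\<close>, and it serves cofinally many stages below a limit stage.\<close>

lemma translate_not_losing:
  assumes D: "D \<in> Complete_Partial_Order.iterates lose" and V: "finite V"
    and B: "\<And>x c. x \<in> B \<Longrightarrow> cmod c = 1 \<Longrightarrow> eventually (\<lambda>y. x + c *\<^sub>C y \<in> B) U"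
    and cover: "\<And>x. x \<in> B \<Longrightarrow> norm x \<le> r \<Longrightarrow> \<exists>v\<in>V. norm (v + x) \<le> r'"
    and x: "x \<in> B" "norm x \<le> r" "x \<notin> D r"
  shows "\<exists>v\<in>V. norm (v + x) \<le> r' \<and> v + x \<notin> D r'"
  using D x
proof (induction arbitrary: x rule: iterates.induct)
  case (step D)
  obtain c where c: "cmod c = 1" "eventually (\<lambda>y. norm (x + c *\<^sub>C y) \<le> r \<and> x + c *\<^sub>C y \<notin> D r) U"
    using step.prems(3) by (auto simp: not_lose_iff)
  \<comment> \<open>Generic successors of \<open>x\<close> stay in \<open>B\<close>, so the
    induction hypothesis, with its covering assumption, applies to them.\<close>
  have "eventually (\<lambda>y. \<exists>v\<in>V. norm (v + x + c *\<^sub>C y) \<le> r' \<and> v + x + c *\<^sub>C y \<notin> D r') U"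
    using c(2) B[OF step.prems(1) c(1)]
  proof eventually_elim
    case (elim y)
    then show ?case using step.IH[of "x + c *\<^sub>C y"] by (simp add: add.assoc)
  qed
  from eventually_bex_finite[OF V this] obtain v where v: "v \<in> V"
    "eventually (\<lambda>y. norm (v + x + c *\<^sub>C y) \<le> r' \<and> v + x + c *\<^sub>C y \<notin> D r') U"
    by blast
  have "norm (v + x) \<le> r'"
    using v(2) by (intro eventually_norm_le[of "v + x" c]) (auto elim: eventually_mono)
  then show ?case using v c(1) not_lose_iff by blast
next
  case (Sup M)
  define V0 where "V0 = {v\<in>V. norm (v + x) \<le> r'}"
  have V0: "finite V0" "V0 \<noteq> {}" using V cover[OF Sup.prems(1,2)] by (auto simp: V0_def)
  show ?case
  proof (rule ccontr)
    assume "\<not> ?thesis"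
    then have "\<forall>v\<in>V0. \<exists>L\<in>M. v + x \<in> L r'" by (auto simp: V0_def)
    then obtain f where f: "\<And>v. v \<in> V0 \<Longrightarrow> f v \<in> M \<and> v + x \<in> f v r'" by metis
    \<comment> \<open>In a chain, the supremum of finitely many stages is one of them: a single
      stage of \<open>M\<close> at which all candidates in \<open>V0\<close> are lost.\<close>
    have "Sup (f ` V0) \<in> f ` V0"
      using V0 f by (intro in_chain_finite chain_subset[OF Sup.hyps(1)]) auto
    then have S: "Sup (f ` V0) \<in> M" using f by auto
    have in_S: "v + x \<in> Sup (f ` V0) r'" if "v \<in> V0" for v
      using f[OF that] that by auto
    have "x \<notin> Sup (f ` V0) r" using Sup.prems(3) S by auto
    then have "\<exists>v\<in>V. norm (v + x) \<le> r' \<and> v + x \<notin> Sup (f ` V0) r'"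
      using Sup.IH S Sup.prems(1,2) by auto
    then show False using in_S by (auto simp: V0_def)
  qed
qed

text \<open>If \<open>0\<close> were lost for \<open>r\<close> at the next stage, generic unit
  vectors would be bad, and a finite \<open>V\<close> of bad positions would serve as prefixes for
  the play from \<open>0\<close> that survives for \<open>r1 < r\<close>. By
  \<open>translate_not_losing\<close> some \<open>v \<in> V\<close> would survive for
  \<open>r\<close>, contrary to being bad.\<close>

lemma zero_not_losing:
  assumes H: "no_torally_separated TYPE('a)"
    and D: "D \<in> Complete_Partial_Order.iterates lose" and r: "1 < r"
  shows "0 \<notin> D r"
  using D r
proof (induction arbitrary: r rule: iterates.induct)
  case (step D)
  show ?case
  proof
    assume 0: "0 \<in> lose D r"
    define r1 where "r1 = (1 + r) / 2"
    have r1: "1 < r1" "r1 < r" using step.prems by (auto simp: r1_def)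
    \<comment> \<open>Generic moves from \<open>Bad\<close> remain in \<open>Bad\<close> because
      iterates satisfy \<open>D \<le> lose D\<close>; from \<open>0\<close> they enter
      \<open>Bad\<close> by assumption. So \<open>insert 0 Bad\<close> can serve as the set
      \<open>B\<close> of \<open>translate_not_losing\<close>.\<close>
    define Bad where "Bad = {x. r < norm x \<or> x \<in> D r}"
    define T where "T = Bad \<inter> cball 0 r1"
    have start: "eventually (\<lambda>y. c *\<^sub>C y \<in> Bad) U" if "cmod c = 1" for c
      using 0 that by (simp add: lose_def Bad_def)
    have "eventually (\<lambda>y. y \<in> Bad) U" using start[of 1] by (simp add: scaleC_one)
    then have "eventually (\<lambda>y. y \<in> T) U"
      using norm_one by eventually_elim (use r1 in \<open>auto simp: T_def\<close>)
    then have "T \<noteq> {}" using nontrivial by (auto simp: trivial_limit_def)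
    have rot: "\<theta> *\<^sub>C x \<in> T" if "x \<in> T" "cmod \<theta> = 1" for x \<theta>
      using that lose_rotate[OF step.hyps that(2)] by (auto simp: T_def Bad_def norm_scaleC)
    have "0 < r1" "T \<subseteq> cball 0 r1" using r1 by (auto simp: T_def)
    from no_torally_separated_translates[OF H this(1) r1(2) this(2) \<open>T \<noteq> {}\<close> rot]
    obtain V where V: "V \<subseteq> T" "finite V" "V \<noteq> {}" "\<And>x. x \<in> T \<Longrightarrow> \<exists>v\<in>V. norm (v + x) \<le> r"
      by auto
    have "\<exists>v\<in>V. norm (v + 0) \<le> r \<and> v + 0 \<notin> D r"
    proof (rule translate_not_losing[where B="insert 0 Bad" and r=r1, OF step.hyps V(2)])
      fix x c assume x: "x \<in> insert 0 Bad" and c: "cmod c = 1"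
      have "eventually (\<lambda>y. x + c *\<^sub>C y \<in> Bad) U"
      proof (cases "x = 0")
        case True
        then show ?thesis using start[OF c] by simp
      next
        case False
        then have xB: "x \<in> Bad" using x by simp
        show ?thesis
        proof (rule ccontr)
          assume "\<not> ?thesis"
          then have ev: "eventually (\<lambda>y. norm (x + c *\<^sub>C y) \<le> r \<and> x + c *\<^sub>C y \<notin> D r) U"
            by (simp add: not_eventually Bad_def not_less)
          then have "norm x \<le> r" by (intro eventually_norm_le[of x c]) (auto elim: eventually_mono)
          moreover have "x \<notin> lose D r" using ev c not_lose_iff by blast
          then have "x \<notin> D r" using iterates_le_f[OF step.hyps mono_lose] by (auto simp: le_fun_def)
          ultimately show False using xB by (simp add: Bad_def)
        qed
      qed
      then show "eventually (\<lambda>y. x + c *\<^sub>C y \<in> insert 0 Bad) U" by (auto elim: eventually_mono)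
    next
      fix x assume x: "x \<in> insert 0 Bad" "norm x \<le> r1"
      show "\<exists>v\<in>V. norm (v + x) \<le> r"
      proof (cases "x = 0")
        case True
        obtain v where "v \<in> V" using V(3) by blast
        moreover have "norm v \<le> r" using V(1) r1 calculation by (auto simp: T_def)
        ultimately show ?thesis using True by auto
      next
        case False
        then show ?thesis using x V(4) by (auto simp: T_def)
      qed
    qed (use r1 step.IH in auto)
    then show False using V(1) by (auto simp: T_def Bad_def)
  qed
next
  case (Sup M)
  then show ?case by auto
qed

text \<open>The least fixed point of \<open>lose\<close> is itself one of the transfinite iterates,
  so \<open>0\<close> lies outside it at radius \<open>2\<close>. A position outside a fixed point
  has a move that generically stays outside.\<close>

lemma exists_winning_set:
  assumes "no_torally_separated TYPE('a)"
  shows "\<exists>W. W \<noteq> {} \<and> W \<subseteq> cball 0 2 \<and> (\<forall>s\<in>W. \<exists>c. cmod c = 1 \<and> eventually (\<lambda>y. s + c *\<^sub>C y \<in> W) U)"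
proof -
  let ?L = "ccpo_class.fixp lose"
  define W where "W = {s. norm s \<le> 2 \<and> s \<notin> ?L 2}"
  have "0 \<in> W" using zero_not_losing[OF assms iterates_fixp[OF mono_lose], of 2] by (simp add: W_def)
  moreover have "\<exists>c. cmod c = 1 \<and> eventually (\<lambda>y. s + c *\<^sub>C y \<in> W) U" if "s \<in> W" for s
  proof -
    have "s \<notin> lose ?L 2" using that fixp_unfold[OF mono_lose] by (simp add: W_def)
    then show ?thesis by (simp add: not_lose_iff W_def)
  qed
  moreover have "W \<subseteq> cball 0 2" by (auto simp: W_def)
  ultimately show ?thesis by blast
qed

end


section \<open>Bounded sums over finite sets\<close>

text \<open>A partial sum with coefficients in \<open>[0, 1]\<close> is a convex combination of sums over subsets.\<close>

lemma norm_sum_scaleR_le: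
  fixes y :: "'i \<Rightarrow> 'a::real_normed_vector"
  assumes "finite S" "\<And>F. F \<subseteq> S \<Longrightarrow> norm (x + (\<Sum>j\<in>F. y j)) \<le> M" "\<And>j. 0 \<le> t j \<and> t j \<le> 1"
  shows "norm (x + (\<Sum>j\<in>S. t j *\<^sub>R y j)) \<le> M"
  using assms(1,2)
proof (induction S arbitrary: x)
  case empty
  then show ?case using empty.prems[of "{}"] by simp
next
  case (insert i S)
  let ?s = "\<Sum>j\<in>S. t j *\<^sub>R y j"
  have a: "norm (x + ?s) \<le> M"
    by (rule insert.IH) (rule insert.prems, blast)
  have b: "norm (x + y i + ?s) \<le> M"
  proof (rule insert.IH)
    fix F assume F: "F \<subseteq> S"
    then have "i \<notin> F" "finite F" using insert.hyps finite_subset by auto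
    then show "norm (x + y i + (\<Sum>j\<in>F. y j)) \<le> M"
      using insert.prems[of "insert i F"] F by (auto simp: add.assoc)
  qed
  have "x + (\<Sum>j\<in>insert i S. t j *\<^sub>R y j) = (1 - t i) *\<^sub>R (x + ?s) + t i *\<^sub>R (x + y i + ?s)"
    using insert.hyps by (simp add: algebra_simps)
  then have "norm (x + (\<Sum>j\<in>insert i S. t j *\<^sub>R y j)) \<le> (1 - t i) * norm (x + ?s) + t i * norm (x + y i + ?s)"
    using norm_triangle_ineq[of "(1 - t i) *\<^sub>R (x + ?s)" "t i *\<^sub>R (x + y i + ?s)"] assms(3)[of i] by simp
  also have "\<dots> \<le> (1 - t i) * M + t i * M"
    using a b assms(3)[of i] by (intro add_mono mult_left_mono) auto
  finally show ?case by (simp add: algebra_simps)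
qed

text \<open>The factor \<open>4\<close> counts the positive and negative parts of the real and
  imaginary parts of the coefficients, each with values in \<open>[0, 1]\<close>.\<close>

lemma norm_sum_scaleC_le:
  fixes y :: "'i \<Rightarrow> 'a::complex_normed_vector"
  assumes "finite S" "\<And>F. F \<subseteq> S \<Longrightarrow> norm (\<Sum>j\<in>F. y j) \<le> M" "\<And>j. j \<in> S \<Longrightarrow> cmod (e j) \<le> 1"
  shows "norm (\<Sum>j\<in>S. e j *\<^sub>C y j) \<le> 4 * M"
proof -
  have R: "norm (\<Sum>j\<in>S. t j *\<^sub>R y j) \<le> M" if t: "\<And>j. j \<in> S \<Longrightarrow> 0 \<le> t j \<and> t j \<le> 1" for t :: "'i \<Rightarrow> real"
  proof -
    have "norm (0 + (\<Sum>j\<in>S. (if j \<in> S then t j else 0) *\<^sub>R y j)) \<le> M"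
      by (rule norm_sum_scaleR_le) (use assms(1,2) t in auto)
    moreover have "(\<Sum>j\<in>S. (if j \<in> S then t j else 0) *\<^sub>R y j) = (\<Sum>j\<in>S. t j *\<^sub>R y j)"
      by (intro sum.cong) auto
    ultimately show ?thesis by simp
  qed
  define A B C D where "A = (\<Sum>j\<in>S. max 0 (Re (e j)) *\<^sub>R y j)" and "B = (\<Sum>j\<in>S. max 0 (- Re (e j)) *\<^sub>R y j)"
    and "C = (\<Sum>j\<in>S. max 0 (Im (e j)) *\<^sub>R y j)" and "D = (\<Sum>j\<in>S. max 0 (- Im (e j)) *\<^sub>R y j)"
  have ReIm: "\<bar>Re (e j)\<bar> \<le> 1" "\<bar>Im (e j)\<bar> \<le> 1" if "j \<in> S" for j
    using assms(3)[OF that] abs_Re_le_cmod[of "e j"] abs_Im_le_cmod[of "e j"] by linarith+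
  have "norm A \<le> M" "norm B \<le> M" "norm C \<le> M" "norm D \<le> M"
    unfolding A_def B_def C_def D_def by (intro R; use ReIm in fastforce)+
  moreover have "e j *\<^sub>C y j = max 0 (Re (e j)) *\<^sub>R y j - max 0 (- Re (e j)) *\<^sub>R y j
      + \<i> *\<^sub>C (max 0 (Im (e j)) *\<^sub>R y j - max 0 (- Im (e j)) *\<^sub>R y j)" for j
  proof -
    have "max 0 (Re (e j)) *\<^sub>R y j - max 0 (- Re (e j)) *\<^sub>R y j = Re (e j) *\<^sub>R y j"
      "max 0 (Im (e j)) *\<^sub>R y j - max 0 (- Im (e j)) *\<^sub>R y j = Im (e j) *\<^sub>R y j"
      by (simp_all add: max_def flip: scaleR_diff_left)
    moreover have "e j *\<^sub>C y j = Re (e j) *\<^sub>R y j + \<i> *\<^sub>C (Im (e j) *\<^sub>R y j)"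
      by (subst complex_eq[of "e j"]) (simp add: scaleR_scaleC scaleC_scaleC scaleC_add_left)
    ultimately show ?thesis by simp
  qed
  then have "(\<Sum>j\<in>S. e j *\<^sub>C y j) = A - B + \<i> *\<^sub>C (C - D)"
    unfolding A_def B_def C_def D_def
    by (simp only: sum.distrib sum_subtractf complex_vector.scale_right_diff_distrib complex_vector.scale_sum_right)
  moreover have "norm (A - B + \<i> *\<^sub>C (C - D)) \<le> norm A + norm B + (norm C + norm D)"
    by (rule order_trans[OF norm_triangle_ineq])
      (intro add_mono norm_triangle_ineq4; simp add: norm_scaleC norm_triangle_ineq4)
  ultimately show ?thesis by simp
qed

context weakly_null_ultrafilter
begin

text \<open>Minimality of \<open>B\<close> gives \<open>W \<subseteq> C\<close>. The positions
  \<open>Q\<close> with a move from the disc at \<open>b\<close> into \<open>C\<close> are convex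
  and contain \<open>Wb\<close>, hence its convex hull; passing to the closure \<open>C\<close>
  costs the error \<tau>.\<close>

lemma exists_absorbing_set:
  assumes H: "no_torally_separated TYPE('a)" and \<kappa>: "\<kappa> > 0"
  shows "\<exists>b C. cmod b = 1 \<and> C \<noteq> {} \<and> C \<subseteq> cball 0 2 \<and>
    (\<forall>p\<in>C. \<forall>\<tau>>0. \<exists>c\<in>cball b \<kappa>. eventually (\<lambda>y. \<exists>q\<in>C. norm (p + c *\<^sub>C y - q) < \<tau>) U)"
proof -
  define wins where "wins B W \<longleftrightarrow> W \<noteq> {} \<and> W \<subseteq> cball 0 2 \<and>
    (\<forall>s\<in>W. \<exists>b\<in>B. \<exists>c\<in>cball b \<kappa>. eventually (\<lambda>y. s + c *\<^sub>C y \<in> W) U)" for B :: "complex set" and W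
  obtain A where A: "finite A" "A \<subseteq> sphere (0::complex) 1"
    "\<And>c. cmod c = 1 \<Longrightarrow> \<exists>a\<in>A. cmod (c - a) < \<kappa>"
    using finite_net_circle[OF \<kappa>] by blast
  obtain W0 where W0: "W0 \<noteq> {}" "W0 \<subseteq> cball 0 2"
    "\<And>s. s \<in> W0 \<Longrightarrow> \<exists>c. cmod c = 1 \<and> eventually (\<lambda>y. s + c *\<^sub>C y \<in> W0) U"
    using exists_winning_set[OF H] by blast
  have "wins A W0" unfolding wins_def
  proof (intro conjI ballI)
    fix s assume "s \<in> W0"
    then obtain c where c: "cmod c = 1" "eventually (\<lambda>y. s + c *\<^sub>C y \<in> W0) U" using W0(3) by blast
    obtain a where "a \<in> A" "cmod (c - a) < \<kappa>" using A(3)[OF c(1)] by blast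
    then have "a \<in> A" "c \<in> cball a \<kappa>" by (auto simp: dist_norm norm_minus_commute)
    then show "\<exists>b\<in>A. \<exists>c\<in>cball b \<kappa>. eventually (\<lambda>y. s + c *\<^sub>C y \<in> W0) U" using c(2) by blast
  qed (use W0 in auto)
  then have "{B \<in> Pow A. \<exists>W. wins B W} \<noteq> {}" by auto
  moreover have "finite {B \<in> Pow A. \<exists>W. wins B W}" using A(1) by simp
  ultimately have "\<exists>B\<in>{B \<in> Pow A. \<exists>W. wins B W}. \<forall>B'\<in>{B \<in> Pow A. \<exists>W. wins B W}. B' \<le> B \<longrightarrow> B = B'"
    using finite_has_minimal by blast
  then obtain B where "B \<in> {B \<in> Pow A. \<exists>W. wins B W}"
    and min': "\<forall>B'\<in>{B \<in> Pow A. \<exists>W. wins B W}. B' \<le> B \<longrightarrow> B = B'" ..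
  then have B: "B \<subseteq> A" "\<exists>W. wins B W" by auto
  have min: "B = B'" if "B' \<subseteq> A" "\<exists>W. wins B' W" "B' \<subseteq> B" for B'
    using min' that by blast
  obtain W where W: "wins B W" using B(2) by blast
  then obtain b where b: "b \<in> B" by (force simp: wins_def)
  define Wb where "Wb = {s \<in> W. \<exists>c\<in>cball b \<kappa>. eventually (\<lambda>y. s + c *\<^sub>C y \<in> W) U}"
  define C where "C = closure (convex hull Wb)"
  have C: "closed C" "convex C" by (auto simp: C_def convex_closure)
  have WC: "W \<subseteq> C"
  proof (rule ccontr)
    assume "\<not> W \<subseteq> C"
    have "wins (B - {b}) (W - C)" unfolding wins_def
    proof (intro conjI ballI)
      fix s assume s: "s \<in> W - C"
      have "\<exists>a\<in>B. \<exists>c\<in>cball a \<kappa>. eventually (\<lambda>y. s + c *\<^sub>C y \<in> W) U"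
        using W s unfolding wins_def by simp
      then obtain a c where ac: "a \<in> B" "c \<in> cball a \<kappa>" "eventually (\<lambda>y. s + c *\<^sub>C y \<in> W) U"
        by (elim bexE)
      have "s \<notin> Wb"
        using s hull_subset[of Wb convex] closure_subset[of "convex hull Wb"] unfolding C_def by auto
      then have "a \<noteq> b" using ac s by (auto simp: Wb_def)
      \<comment> \<open>As \<open>s\<close> lies outside the closed convex set \<open>C\<close>, the
        move generically avoids \<open>C\<close>; so \<open>W - C\<close> wins without the disc at
        \<open>b\<close>.\<close>
      have "\<not> eventually (\<lambda>y. s + c *\<^sub>C y \<in> C) U"
        using eventually_in_closed_convex[OF _ C] s by blast
      then have "eventually (\<lambda>y. s + c *\<^sub>C y \<notin> C) U" by (simp add: not_eventually)
      then have "eventually (\<lambda>y. s + c *\<^sub>C y \<in> W - C) U" using ac(3) by eventually_elim auto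
      then show "\<exists>a\<in>B - {b}. \<exists>c\<in>cball a \<kappa>. eventually (\<lambda>y. s + c *\<^sub>C y \<in> W - C) U"
        using ac \<open>a \<noteq> b\<close> by blast
    qed (use W \<open>\<not> W \<subseteq> C\<close> in \<open>auto simp: wins_def\<close>)
    then have "B = B - {b}" using B(1) by (intro min) auto
    then show False using b by auto
  qed
  define Q where "Q = {q. \<exists>c\<in>cball b \<kappa>. eventually (\<lambda>y. q + c *\<^sub>C y \<in> C) U}"
  have "Wb \<subseteq> Q" using WC by (force simp: Wb_def Q_def elim: eventually_mono)
  moreover have "convex Q"
  proof (rule convexI)
    fix q1 q2 and u v :: real
    assume q: "q1 \<in> Q" "q2 \<in> Q" and uv: "0 \<le> u" "0 \<le> v" "u + v = 1"
    obtain c1 c2 where c: "c1 \<in> cball b \<kappa>" "eventually (\<lambda>y. q1 + c1 *\<^sub>C y \<in> C) U"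
      "c2 \<in> cball b \<kappa>" "eventually (\<lambda>y. q2 + c2 *\<^sub>C y \<in> C) U"
      using q by (auto simp: Q_def)
    \<comment> \<open>Averaging two moves averages their coefficients, which may leave the circle
      but not the disc; hence discs instead of unimodular coefficients.\<close>
    have "eventually (\<lambda>y. u *\<^sub>R q1 + v *\<^sub>R q2 + (u *\<^sub>R c1 + v *\<^sub>R c2) *\<^sub>C y \<in> C) U"
      using c(2,4)
    proof eventually_elim
      case (elim y)
      have "u *\<^sub>R (q1 + c1 *\<^sub>C y) + v *\<^sub>R (q2 + c2 *\<^sub>C y) \<in> C"
        using elim C(2) uv by (intro convexD) auto
      moreover have "u *\<^sub>R (q1 + c1 *\<^sub>C y) + v *\<^sub>R (q2 + c2 *\<^sub>C y)
          = u *\<^sub>R q1 + v *\<^sub>R q2 + (u *\<^sub>R c1 + v *\<^sub>R c2) *\<^sub>C y"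
        by (simp add: scaleR_scaleC scaleC_add_right scaleC_add_left scaleC_scaleC scaleR_conv_of_real add_ac)
      ultimately show ?case by simp
    qed
    moreover have "u *\<^sub>R c1 + v *\<^sub>R c2 \<in> cball b \<kappa>"
      using c(1,3) uv by (intro convexD[OF convex_cball]) auto
    ultimately show "u *\<^sub>R q1 + v *\<^sub>R q2 \<in> Q" unfolding Q_def by blast
  qed
  ultimately have hullQ: "convex hull Wb \<subseteq> Q" by (simp add: hull_minimal)
  have "\<exists>c\<in>cball b \<kappa>. eventually (\<lambda>y. \<exists>q\<in>C. norm (p + c *\<^sub>C y - q) < \<tau>) U" if p: "p \<in> C" "\<tau> > 0" for p \<tau>
  proof -
    obtain q where q: "q \<in> convex hull Wb" "dist q p < \<tau>"
      using p unfolding C_def closure_approachable by blast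
    then obtain c where c: "c \<in> cball b \<kappa>" "eventually (\<lambda>y. q + c *\<^sub>C y \<in> C) U"
      using hullQ by (auto simp: Q_def)
    have "eventually (\<lambda>y. \<exists>q\<in>C. norm (p + c *\<^sub>C y - q) < \<tau>) U"
      using c(2)
    proof eventually_elim
      case (elim y)
      have "norm (p + c *\<^sub>C y - (q + c *\<^sub>C y)) < \<tau>" using q(2) by (simp add: dist_norm norm_minus_commute)
      then show ?case using elim by blast
    qed
    then show ?thesis using c(1) by blast
  qed
  moreover have "C \<noteq> {}" "C \<subseteq> cball 0 2"
  proof -
    show "C \<noteq> {}" using WC W by (auto simp: wins_def)
    have "Wb \<subseteq> cball 0 2" using W by (auto simp: wins_def Wb_def)
    then show "C \<subseteq> cball 0 2" unfolding C_def by (intro closure_minimal hull_minimal) auto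
  qed
  moreover have "cmod b = 1" using b B(1) A(2) by auto
  ultimately show ?thesis by blast
qed

text \<open>The vectors are chosen recursively so that, for every
  \<open>F \<subseteq> {..<n}\<close>, a play from \<open>s\<close> using just the
  \<open>y j\<close> with \<open>j \<in> F\<close> ends near \<open>C\<close>. Skipping a vector
  leaves the play where it is.\<close>

lemma exists_bounded_sums:
  assumes H: "no_torally_separated TYPE('a)" and \<kappa>: "\<kappa> > 0"
  shows "\<exists>b. \<exists>y::nat \<Rightarrow> 'a. cmod b = 1 \<and> (\<forall>n. norm (y n) = 1) \<and>
    (\<forall>F. finite F \<longrightarrow> (\<exists>d. (\<forall>j. d j \<in> cball b \<kappa>) \<and> norm (\<Sum>j\<in>F. d j *\<^sub>C y j) \<le> 5))"
proof -
  from exists_absorbing_set[OF H \<kappa>]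
  obtain b C where b: "cmod b = 1" and C: "C \<noteq> {}" "C \<subseteq> cball 0 2"
    and absorb': "\<forall>p\<in>C. \<forall>\<tau>>0. \<exists>c\<in>cball b \<kappa>. eventually (\<lambda>y. \<exists>q\<in>C. norm (p + c *\<^sub>C y - q) < \<tau>) U"
    by (elim exE conjE)
  have absorb: "\<exists>c\<in>cball b \<kappa>. eventually (\<lambda>y. \<exists>q\<in>C. norm (p + c *\<^sub>C y - q) < \<tau>) U"
    if "p \<in> C" "\<tau> > 0" for p \<tau> using absorb' that by simp
  obtain s where s: "s \<in> C" using C(1) by blast
  define near where "near r y F \<longleftrightarrow> (\<exists>p\<in>C. \<exists>d. (\<forall>j. d j \<in> cball b \<kappa>) \<and>
    norm (s + (\<Sum>j\<in>F. d j *\<^sub>C y j) - p) \<le> r)" for r :: real and y :: "nat \<Rightarrow> 'a" and F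
  \<comment> \<open>The tolerance starts at \<open>0\<close> and grows by
    \<open>(1/2) ^ Suc n\<close> when the vector with index \<open>n\<close> is added, so it stays
    below \<open>1\<close>.\<close>
  define good where "good n y \<longleftrightarrow> (\<forall>F\<subseteq>{..<n}. near (1 - (1/2) ^ n) y F)" for n y
  have near_cong: "near r y F \<longleftrightarrow> near r z F" if "\<And>j. j \<in> F \<Longrightarrow> y j = z j" for r y z F
    unfolding near_def using that by (simp cong: sum.cong)
  have good_cong: "good n y \<longleftrightarrow> good n z" if "\<And>j. j < n \<Longrightarrow> y j = z j" for n y z
  proof -
    have "near q y F \<longleftrightarrow> near q z F" if "F \<subseteq> {..<n}" for q F
      using that \<open>\<And>j. j < n \<Longrightarrow> y j = z j\<close> by (intro near_cong) auto
    then show ?thesis unfolding good_def by blast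
  qed
  have near_mono: "near q y F" if "near r y F" "r \<le> q" for q r y F
  proof -
    obtain p d where "p \<in> C" "\<forall>j. d j \<in> cball b \<kappa>" "norm (s + (\<Sum>j\<in>F. d j *\<^sub>C y j) - p) \<le> r"
      using \<open>near r y F\<close> unfolding near_def by blast
    then show ?thesis using \<open>r \<le> q\<close> unfolding near_def by (intro bexI[of _ p] exI[of _ d]) auto
  qed
  have step: "\<exists>r. norm r = 1 \<and> good (Suc n) (y(n := r))" if g: "good n y" for n y
  proof -
    define \<tau> :: real where "\<tau> = (1/2) ^ Suc n"
    have \<tau>: "\<tau> > 0" by (simp add: \<tau>_def)
    have ev: "eventually (\<lambda>r. near (1 - (1/2) ^ Suc n) (y(n := r)) (insert n F)) U"
      if F: "F \<subseteq> {..<n}" for F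
    proof -
      obtain p d where p: "p \<in> C" "\<And>j. d j \<in> cball b \<kappa>"
        "norm (s + (\<Sum>j\<in>F. d j *\<^sub>C y j) - p) \<le> 1 - (1/2) ^ n"
        using g F unfolding good_def near_def by blast
      obtain c where c: "c \<in> cball b \<kappa>" "eventually (\<lambda>r. \<exists>q\<in>C. norm (p + c *\<^sub>C r - q) < \<tau>) U"
        using absorb[OF p(1) \<tau>] by blast
      have nF: "n \<notin> F" "finite F" using F finite_subset by auto
      show ?thesis using c(2)
      proof eventually_elim
        case (elim r)
        then obtain q where q: "q \<in> C" "norm (p + c *\<^sub>C r - q) < \<tau>" by blast
        have "(\<Sum>j\<in>insert n F. (d(n := c)) j *\<^sub>C (y(n := r)) j) = c *\<^sub>C r + (\<Sum>j\<in>F. d j *\<^sub>C y j)"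
          using nF by (auto intro!: sum.cong)
        then have "s + (\<Sum>j\<in>insert n F. (d(n := c)) j *\<^sub>C (y(n := r)) j) - q
            = (s + (\<Sum>j\<in>F. d j *\<^sub>C y j) - p) + (p + c *\<^sub>C r - q)" by simp
        then have "norm (s + (\<Sum>j\<in>insert n F. (d(n := c)) j *\<^sub>C (y(n := r)) j) - q)
            = norm ((s + (\<Sum>j\<in>F. d j *\<^sub>C y j) - p) + (p + c *\<^sub>C r - q))"
          by (rule arg_cong)
        also have "\<dots> \<le> norm (s + (\<Sum>j\<in>F. d j *\<^sub>C y j) - p) + norm (p + c *\<^sub>C r - q)"
          by (rule norm_triangle_ineq)
        also have "\<dots> \<le> (1 - (1/2) ^ n) + \<tau>" using p(3) q(2) by linarith
        also have "\<dots> = 1 - (1/2) ^ Suc n" by (simp add: \<tau>_def)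
        finally show ?case unfolding near_def using q(1) p(2) c(1)
          by (intro bexI[of _ q] exI[of _ "d(n := c)"]) auto
      qed
    qed
    \<comment> \<open>The coefficient \<open>c\<close> may depend on \<open>F\<close>, but only
      finitely many \<open>F\<close> occur, so one generic vector serves them all.\<close>
    have "eventually (\<lambda>r. \<forall>F\<in>Pow {..<n}. near (1 - (1/2) ^ Suc n) (y(n := r)) (insert n F)) U"
      using ev by (intro eventually_ball_finite) auto
    then have "eventually (\<lambda>r. norm r = 1 \<and>
        (\<forall>F\<in>Pow {..<n}. near (1 - (1/2) ^ Suc n) (y(n := r)) (insert n F))) U"
      using norm_one by eventually_elim blast
    from eventually_happens'[OF nontrivial this] obtain r where r: "norm r = 1"
      "\<And>F. F \<subseteq> {..<n} \<Longrightarrow> near (1 - (1/2) ^ Suc n) (y(n := r)) (insert n F)"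
      by auto
    have "near (1 - (1/2) ^ Suc n) (y(n := r)) G" if G: "G \<subseteq> {..<Suc n}" for G
    proof (cases "n \<in> G")
      case True
      have "G - {n} \<subseteq> {..<n}" using G by (auto simp: less_Suc_eq)
      then show ?thesis using r(2)[of "G - {n}"] True by (simp add: insert_absorb)
    next
      case False
      then have "G \<subseteq> {..<n}" using G by (auto simp: less_Suc_eq subset_iff)
      then have "near (1 - (1/2) ^ n) y G" using g by (simp add: good_def)
      then have "near (1 - (1/2) ^ Suc n) y G"
        by (rule near_mono) simp
      moreover have "near (1 - (1/2) ^ Suc n) y G \<longleftrightarrow> near (1 - (1/2) ^ Suc n) (y(n := r)) G"
        using False by (intro near_cong) auto
      ultimately show ?thesis by blast
    qed
    then have "good (Suc n) (y(n := r))" unfolding good_def by blast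
    then show ?thesis using r(1) by blast
  qed
  have "\<exists>y::nat \<Rightarrow> 'a. \<forall>n. norm (y n) = 1 \<and> good (Suc n) (y(n := y n))"
  proof (rule dependent_wellorder_choice)
    fix r n and y z :: "nat \<Rightarrow> 'a" assume "\<And>j. j < n \<Longrightarrow> y j = z j"
    then have "good (Suc n) (y(n := r)) \<longleftrightarrow> good (Suc n) (z(n := r))"
      by (intro good_cong) auto
    then show "(norm r = 1 \<and> good (Suc n) (y(n := r))) = (norm r = 1 \<and> good (Suc n) (z(n := r)))" by simp
  next
    fix n and y :: "nat \<Rightarrow> 'a"
    assume y: "\<And>m. m < n \<Longrightarrow> norm (y m) = 1 \<and> good (Suc m) (y(m := y m))"
    have "good n y"
    proof (cases n)
      case 0
      have "b \<in> cball b \<kappa>" using \<kappa> by simp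
      then have "near 0 y {}" unfolding near_def using s by (intro bexI[of _ s] exI[of _ "\<lambda>_. b"]) auto
      then show ?thesis using 0 by (simp add: good_def)
    next
      case (Suc m)
      then show ?thesis using y[of m] by simp
    qed
    then show "\<exists>r. norm r = 1 \<and> good (Suc n) (y(n := r))" by (rule step)
  qed
  then obtain y :: "nat \<Rightarrow> 'a" where y: "\<forall>n. norm (y n) = 1 \<and> good (Suc n) (y(n := y n))" ..
  have "\<exists>d. (\<forall>j. d j \<in> cball b \<kappa>) \<and> norm (\<Sum>j\<in>F. d j *\<^sub>C y j) \<le> 5" if F: "finite F" for F
  proof -
    obtain n where "F \<subseteq> {..<n}" using finite_nat_iff_bounded F by blast
    then have "F \<subseteq> {..<Suc n}" by auto
    moreover have "good (Suc n) y" using y by simp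
    ultimately obtain p d where p: "p \<in> C" "\<forall>j. d j \<in> cball b \<kappa>"
      "norm (s + (\<Sum>j\<in>F. d j *\<^sub>C y j) - p) \<le> 1 - (1/2) ^ Suc n"
      unfolding good_def near_def by blast
    \<comment> \<open>The bound \<open>5\<close> is \<open>1\<close> for the distance to
      \<open>p\<close> plus \<open>2\<close> each for \<open>p\<close> and \<open>s\<close>.\<close>
    have "(\<Sum>j\<in>F. d j *\<^sub>C y j) = (s + (\<Sum>j\<in>F. d j *\<^sub>C y j) - p) + (p - s)" by simp
    then have "norm (\<Sum>j\<in>F. d j *\<^sub>C y j) = norm ((s + (\<Sum>j\<in>F. d j *\<^sub>C y j) - p) + (p - s))"
      by (rule arg_cong)
    moreover have "\<dots> \<le> norm (s + (\<Sum>j\<in>F. d j *\<^sub>C y j) - p) + norm (p - s)"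
      by (rule norm_triangle_ineq)
    moreover have "norm (p - s) \<le> norm p + norm s" by (rule norm_triangle_ineq4)
    moreover have "norm p \<le> 2" "norm s \<le> 2" using C(2) p(1) s by auto
    moreover have "(1/2 :: real) ^ Suc n \<ge> 0" by simp
    ultimately have "norm (\<Sum>j\<in>F. d j *\<^sub>C y j) \<le> 5" using p(3) by linarith
    then show ?thesis using p(2) by blast
  qed
  then show ?thesis using b y by blast
qed

text \<open>The coefficients \<open>d j\<close> above depend on \<open>F\<close>. As they stay close to \<open>b\<close>, the largest of the
  finitely many sums over subsets of \<open>{..<n}\<close> bounds the error of replacing them by \<open>b\<close>, with a small factor.\<close>

lemma exists_weakly_unconditionally_Cauchy:
  assumes H: "no_torally_separated TYPE('a)"
  shows "\<exists>y::nat \<Rightarrow> 'a. (\<forall>n. norm (y n) = 1) \<and>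
    (\<forall>F e. finite F \<longrightarrow> (\<forall>j\<in>F. cmod (e j) \<le> 1) \<longrightarrow> norm (\<Sum>j\<in>F. e j *\<^sub>C y j) \<le> 40)"
proof -
  obtain b and y :: "nat \<Rightarrow> 'a" where b: "cmod b = 1" and y: "\<forall>n. norm (y n) = 1"
    and d: "\<And>F. finite F \<Longrightarrow> \<exists>d. (\<forall>j. d j \<in> cball b (1/8)) \<and> norm (\<Sum>j\<in>F. d j *\<^sub>C y j) \<le> 5"
    using exists_bounded_sums[OF H, of "1/8"] by auto
  have "norm (\<Sum>j\<in>F. e j *\<^sub>C y j) \<le> 40" if F: "finite F" and e: "\<forall>j\<in>F. cmod (e j) \<le> 1" for F e
  proof -
    define M where "M = Max ((\<lambda>G. norm (\<Sum>j\<in>G. y j)) ` Pow F)"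
    have fin: "finite ((\<lambda>G. norm (\<Sum>j\<in>G. y j)) ` Pow F)" using F by simp
    have M: "norm (\<Sum>j\<in>G. y j) \<le> M" if "G \<subseteq> F" for G
      unfolding M_def using fin that by (intro Max_ge) auto
    have "M \<in> (\<lambda>G. norm (\<Sum>j\<in>G. y j)) ` Pow F" unfolding M_def using fin by (intro Max_in) auto
    then obtain G where G: "G \<subseteq> F" "M = norm (\<Sum>j\<in>G. y j)" by auto
    have finG: "finite G" using G(1) F finite_subset by blast
    obtain d where d: "\<And>j. d j \<in> cball b (1/8)" "norm (\<Sum>j\<in>G. d j *\<^sub>C y j) \<le> 5"
      using d[OF finG] by blast
    \<comment> \<open>Scaling by \<open>8\<close> makes the differences admissible coefficients. The
      error is then at most \<open>4 * M / 8\<close>, so \<open>M \<le> 5 + M / 2\<close>, that is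
      \<open>M \<le> 10\<close>, and \<open>40 = 4 * 10\<close>.\<close>
    have "cmod (8 * (b - d j)) \<le> 1" for j using d(1)[of j] by (simp only: norm_mult) (simp add: dist_norm)
    then have "norm (\<Sum>j\<in>G. (8 * (b - d j)) *\<^sub>C y j) \<le> 4 * M"
      using M G(1) finG by (intro norm_sum_scaleC_le) auto
    moreover have "(\<Sum>j\<in>G. (8 * (b - d j)) *\<^sub>C y j) = 8 *\<^sub>C (\<Sum>j\<in>G. (b - d j) *\<^sub>C y j)"
      by (simp add: complex_vector.scale_sum_right scaleC_scaleC)
    ultimately have 1: "8 * norm (\<Sum>j\<in>G. (b - d j) *\<^sub>C y j) \<le> 4 * M" by (simp add: norm_scaleC)
    have "b *\<^sub>C (\<Sum>j\<in>G. y j) = (\<Sum>j\<in>G. d j *\<^sub>C y j) + (\<Sum>j\<in>G. (b - d j) *\<^sub>C y j)"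
      by (simp add: complex_vector.scale_sum_right complex_vector.scale_left_diff_distrib sum_subtractf)
    then have "norm (b *\<^sub>C (\<Sum>j\<in>G. y j)) \<le> 5 + norm (\<Sum>j\<in>G. (b - d j) *\<^sub>C y j)"
      using d(2) norm_triangle_ineq[of "\<Sum>j\<in>G. d j *\<^sub>C y j" "\<Sum>j\<in>G. (b - d j) *\<^sub>C y j"] by simp
    then have "M \<le> 10" using 1 b G(2) by (simp add: norm_scaleC)
    moreover have "norm (\<Sum>j\<in>F. e j *\<^sub>C y j) \<le> 4 * M"
      using M F e by (intro norm_sum_scaleC_le) auto
    ultimately show ?thesis by linarith
  qed
  then show ?thesis using y by blast
qed

end


section \<open>Separated vectors in copies of $c_0$\<close>

text \<open>Flipping the signs of all other terms and adding leaves \<open>2 c\<^sub>l u\<^sub>l\<close>, so the upper estimate gives a lower one.\<close>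

lemma norm_sum_ge_coefficient:
  fixes u :: "nat \<Rightarrow> 'a::complex_normed_vector"
  assumes G: "finite G" "l \<in> G" and l: "\<And>k. k \<in> G \<Longrightarrow> cmod (c k) \<le> cmod (c l)"
    and upper: "\<And>c. (\<And>k. k \<in> G \<Longrightarrow> cmod (c k) \<le> 1) \<Longrightarrow> norm (\<Sum>k\<in>G. c k *\<^sub>C u k) \<le> B"
    and lower: "A \<le> norm (u l)"
  shows "cmod (c l) * (2 * A - B) \<le> norm (\<Sum>k\<in>G. c k *\<^sub>C u k)"
proof (cases "c l = 0")
  case True
  then show ?thesis by simp
next
  case False
  define \<beta> where "\<beta> = cmod (c l)"
  have \<beta>: "\<beta> > 0" using False by (simp add: \<beta>_def)
  define c' where "c' k = (if k = l then c l else - c k) / \<beta>" for k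
  have "norm (\<Sum>k\<in>G. c' k *\<^sub>C u k) \<le> B"
    using l \<beta> by (intro upper) (auto simp: c'_def \<beta>_def norm_divide)
  then have "\<beta> * norm (\<Sum>k\<in>G. c' k *\<^sub>C u k) \<le> \<beta> * B" using \<beta> by simp
  moreover have "(\<Sum>k\<in>G. c k *\<^sub>C u k) + of_real \<beta> *\<^sub>C (\<Sum>k\<in>G. c' k *\<^sub>C u k) = (2 * c l) *\<^sub>C u l"
  proof -
    have "(\<Sum>k\<in>G. c k *\<^sub>C u k) + of_real \<beta> *\<^sub>C (\<Sum>k\<in>G. c' k *\<^sub>C u k)
        = (\<Sum>k\<in>G. if k = l then (2 * c l) *\<^sub>C u l else 0)"
      unfolding complex_vector.scale_sum_right sum.distrib[symmetric]
      using \<beta> by (intro sum.cong)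
        (auto simp: c'_def scaleC_scaleC simp flip: scaleC_add_left)
    then show ?thesis using G by simp
  qed
  then have "norm ((2 * c l) *\<^sub>C u l) \<le> norm (\<Sum>k\<in>G. c k *\<^sub>C u k) + norm (of_real \<beta> *\<^sub>C (\<Sum>k\<in>G. c' k *\<^sub>C u k))"
    by (metis norm_triangle_ineq)
  then have "2 * \<beta> * norm (u l) \<le> norm (\<Sum>k\<in>G. c k *\<^sub>C u k) + \<beta> * norm (\<Sum>k\<in>G. c' k *\<^sub>C u k)"
    using \<beta> by (simp add: norm_scaleC norm_mult \<beta>_def)
  moreover have "2 * \<beta> * A \<le> 2 * \<beta> * norm (u l)" using lower \<beta> by (intro mult_left_mono) auto
  ultimately show ?thesis by (simp add: \<beta>_def[symmetric] algebra_simps)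
qed

text \<open>James' argument: beyond some index the supremum of the norms of sums with coefficients in the unit disc
  is almost constant, so blocks nearly attaining it satisfy an almost isometric upper \<open>c\<^sub>0\<close> estimate.\<close>

lemma exists_almost_isometric_blocks:
  fixes y :: "nat \<Rightarrow> 'a::complex_normed_vector"
  assumes y: "\<And>n. norm (y n) = 1"
    and bound: "\<And>F e. finite F \<Longrightarrow> (\<And>j. j \<in> F \<Longrightarrow> cmod (e j) \<le> 1) \<Longrightarrow> norm (\<Sum>j\<in>F. e j *\<^sub>C y j) \<le> K"
    and \<delta>: "\<delta> > 0"
  shows "\<exists>L\<ge>1. \<exists>u::nat \<Rightarrow> 'a. (\<forall>i. L * (1 - \<delta>) \<le> norm (u i)) \<and>
    (\<forall>G c. finite G \<longrightarrow> (\<forall>i\<in>G. cmod (c i) \<le> 1) \<longrightarrow> norm (\<Sum>i\<in>G. c i *\<^sub>C u i) \<le> L * (1 + \<delta>))"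
proof -
  define S where "S n = {norm (\<Sum>j\<in>F. e j *\<^sub>C y j) | F e. finite F \<and> F \<subseteq> {n..} \<and> (\<forall>j\<in>F. cmod (e j) \<le> 1)}" for n
  have SI: "norm (\<Sum>j\<in>F. e j *\<^sub>C y j) \<in> S n" if "finite F" "F \<subseteq> {n..}" "\<And>j. j \<in> F \<Longrightarrow> cmod (e j) \<le> 1" for F e n
    unfolding S_def using that by blast
  have bdd: "bdd_above (S n)" for n
    using bound by (intro bdd_aboveI[where M=K]) (auto simp: S_def)
  have one: "1 \<in> S n" for n using SI[of "{n}" n "\<lambda>_. 1"] y by (simp add: scaleC_one)
  define k where "k n = Sup (S n)" for n
  have k1: "1 \<le> k n" for n unfolding k_def using bdd one by (intro cSup_upper)
  \<comment> \<open>\<open>L\<close> is the infimum of the tail suprema: every tail contains a block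
    of norm above \<open>L * (1 - \<delta>)\<close>, while beyond a suitable \<open>n0\<close> all
    sums stay below \<open>L * (1 + \<delta>)\<close>.\<close>
  define L where "L = (INF n. k n)"
  have bk: "bdd_below (range k)" using k1 by (intro bdd_belowI2)
  have L1: "1 \<le> L" unfolding L_def using k1 by (intro cINF_greatest) auto
  have Lk: "L \<le> k n" for n unfolding L_def using bk by (intro cINF_lower) auto
  have "L < L * (1 + \<delta>)" using L1 \<delta> by simp
  then have "\<exists>x\<in>range k. x < L * (1 + \<delta>)"
    unfolding L_def using bk by (subst (asm) cInf_less_iff) auto
  then obtain n0 where n0: "k n0 < L * (1 + \<delta>)" by auto
  have "\<exists>F e. finite F \<and> F \<subseteq> {n..} \<and> (\<forall>j\<in>F. cmod (e j) \<le> 1) \<and> L * (1 - \<delta>) < norm (\<Sum>j\<in>F. e j *\<^sub>C y j)" for n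
  proof -
    have "L * (1 - \<delta>) < k n" using Lk[of n] L1 \<delta> by (smt (verit) mult_less_cancel_left2)
    then obtain z where "z \<in> S n" "L * (1 - \<delta>) < z"
      unfolding k_def using bdd one by (subst (asm) less_cSup_iff) auto
    then show ?thesis by (auto simp: S_def)
  qed
  then obtain F e where F: "\<And>n. finite (F n)" "\<And>n. F n \<subseteq> {n..}" "\<And>n j. j \<in> F n \<Longrightarrow> cmod (e n j) \<le> 1"
    "\<And>n. L * (1 - \<delta>) < norm (\<Sum>j\<in>F n. e n j *\<^sub>C y j)"
    by metis
  \<comment> \<open>Each block starts past the previous one; inserting \<open>m\<close> keeps
    \<open>Max\<close> meaningful for an empty block and makes \<open>g\<close> strictly
    increasing.\<close>
  define g where "g = rec_nat n0 (\<lambda>_ m. Suc (Max (insert m (F m))))"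
  have g0: "g 0 = n0" and gS: "g (Suc i) = Suc (Max (insert (g i) (F (g i))))" for i
    by (simp_all add: g_def)
  have gF: "j < g (Suc i)" if "j \<in> F (g i)" for i j
    unfolding gS using that F(1) by (simp add: less_Suc_eq_le Max_ge_iff)
  have "g i < g (Suc i)" for i
    unfolding gS using F(1) by (simp add: less_Suc_eq_le Max_ge_iff)
  then have gmono: "strict_mono g" by (simp add: strict_mono_Suc_iff)
  have disj: "i = i'" if "j \<in> F (g i)" "j \<in> F (g i')" for i i' j
  proof -
    have "\<not> i < i'" if "j \<in> F (g i)" "j \<in> F (g i')" for i i'
    proof
      assume "i < i'"
      then have "g (Suc i) \<le> g i'" using gmono by (simp add: strict_mono_less_eq Suc_leI)
      then show False using gF[OF that(1)] F(2)[of "g i'"] that(2) by auto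
    qed
    then show ?thesis using that by (meson nat_neq_iff)
  qed
  define u where "u i = (\<Sum>j\<in>F (g i). e (g i) j *\<^sub>C y j)" for i
  have "norm (\<Sum>i\<in>G. c i *\<^sub>C u i) \<le> L * (1 + \<delta>)" if G: "finite G" and c: "\<forall>i\<in>G. cmod (c i) \<le> 1" for G c
  proof -
    \<comment> \<open>Disjointness lets a combination of blocks be rewritten as one sum of the
      \<open>y j\<close> with coefficients in the unit disc, which \<open>k n0\<close>
      bounds.\<close>
    define idx where "idx j = (THE i. j \<in> F (g i))" for j
    have idx: "idx j = i" if "j \<in> F (g i)" for i j
      unfolding idx_def using that disj by blast
    define d where "d j = c (idx j) * e (g (idx j)) j" for j
    let ?F = "\<Union>i\<in>G. F (g i)"
    have "(\<Sum>j\<in>?F. d j *\<^sub>C y j) = (\<Sum>i\<in>G. \<Sum>j\<in>F (g i). d j *\<^sub>C y j)"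
      using G F(1) disj by (intro sum.UNION_disjoint) auto
    also have "\<dots> = (\<Sum>i\<in>G. c i *\<^sub>C u i)"
      unfolding u_def complex_vector.scale_sum_right
      by (intro sum.cong refl) (simp add: d_def idx scaleC_scaleC)
    finally have eq: "(\<Sum>i\<in>G. c i *\<^sub>C u i) = (\<Sum>j\<in>?F. d j *\<^sub>C y j)" by simp
    have "norm (\<Sum>j\<in>?F. d j *\<^sub>C y j) \<in> S n0"
    proof (rule SI)
      have "n0 \<le> g i" for i using gmono g0 by (metis le0 strict_mono_less_eq)
      then show "?F \<subseteq> {n0..}" using F(2) by (meson UN_least atLeast_subset_iff order_trans)
      fix j assume "j \<in> ?F"
      then obtain i where i: "i \<in> G" "j \<in> F (g i)" by blast
      have "cmod (c i) * cmod (e (g i) j) \<le> 1 * 1"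
        using c i F(3)[OF i(2)] by (intro mult_mono) auto
      then show "cmod (d j) \<le> 1" using i by (simp add: d_def idx norm_mult)
    qed (use G F(1) in auto)
    then have "norm (\<Sum>j\<in>?F. d j *\<^sub>C y j) \<le> k n0" unfolding k_def by (rule cSup_upper[OF _ bdd])
    then show ?thesis using n0 eq by simp
  qed
  moreover have "L * (1 - \<delta>) \<le> norm (u i)" for i using F(4)[of "g i"] by (simp add: u_def)
  ultimately show ?thesis using L1 by blast
qed

text \<open>By the parallelogram law the two squares add up to \<open>4\<close>, so one is at least
  \<open>2\<close>, and \<open>7 / 5\<close> is below the square root of \<open>2\<close>.\<close>

lemma cmod_one_minus_or_plus:
  assumes "cmod \<theta> = 1"
  shows "7 / 5 \<le> cmod (1 - \<theta>) \<or> 7 / 5 \<le> cmod (1 + \<theta>)"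
proof (rule ccontr)
  assume "\<not> ?thesis"
  then have "(cmod (1 - \<theta>))\<^sup>2 < (7/5)\<^sup>2" "(cmod (1 + \<theta>))\<^sup>2 < (7/5)\<^sup>2"
    by (auto intro!: power_strict_mono)
  moreover have "(cmod (1 - \<theta>))\<^sup>2 + (cmod (1 + \<theta>))\<^sup>2 = 2 + 2 * (cmod \<theta>)\<^sup>2"
    unfolding cmod_power2 by (simp add: power2_eq_square algebra_simps)
  ultimately show False using assms by (simp add: power2_eq_square)
qed

text \<open>With \<open>x n = u 0 + ... + u n - u (Suc n)\<close>, the difference
  \<open>x n - \<theta> *\<^sub>C x m\<close> has coefficient \<open>1 - \<theta>\<close> at
  \<open>0\<close> and \<open>1 + \<theta>\<close> at \<open>Suc m\<close>. One of them has modulus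
  at least \<open>7 / 5\<close>, and almost isometric blocks nearly preserve this.\<close>

lemma torally_separated_of_bounded_sums:
  fixes y :: "nat \<Rightarrow> 'a::complex_normed_vector"
  assumes y: "\<And>n. norm (y n) = 1"
    and bound: "\<And>F e. finite F \<Longrightarrow> (\<And>j. j \<in> F \<Longrightarrow> cmod (e j) \<le> 1) \<Longrightarrow> norm (\<Sum>j\<in>F. e j *\<^sub>C y j) \<le> K"
  shows "\<exists>x::nat \<Rightarrow> 'a. (\<forall>n. norm (x n) = 1) \<and> torally_separated (1 + 1 / 5) x"
proof -
  define \<delta> :: real where "\<delta> = 1 / 50"
  have "\<exists>L\<ge>1. \<exists>u::nat \<Rightarrow> 'a. (\<forall>i. L * (1 - \<delta>) \<le> norm (u i)) \<and>
    (\<forall>G c. finite G \<longrightarrow> (\<forall>i\<in>G. cmod (c i) \<le> 1) \<longrightarrow> norm (\<Sum>i\<in>G. c i *\<^sub>C u i) \<le> L * (1 + \<delta>))"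
    by (rule exists_almost_isometric_blocks[of y K \<delta>, OF y bound]) (auto simp: \<delta>_def)
  then obtain L and u :: "nat \<Rightarrow> 'a" where L: "L \<ge> 1" and lower: "\<forall>i. L * (1 - \<delta>) \<le> norm (u i)"
    and upper: "\<forall>G c. finite G \<longrightarrow> (\<forall>i\<in>G. cmod (c i) \<le> 1) \<longrightarrow> norm (\<Sum>i\<in>G. c i *\<^sub>C u i) \<le> L * (1 + \<delta>)"
    by (elim exE conjE)
  define a :: "nat \<Rightarrow> nat \<Rightarrow> complex" where "a n k = (if k \<le> n then 1 else if k = Suc n then - 1 else 0)" for n k
  define x where "x n = (\<Sum>k\<le>Suc n. a n k *\<^sub>C u k)" for n
  have x_eq: "x n = (\<Sum>k\<le>N. a n k *\<^sub>C u k)" if "Suc n \<le> N" for n N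
    unfolding x_def using that by (intro sum.mono_neutral_left) (auto simp: a_def)
  have "norm (x n) \<le> L * (1 + \<delta>)" for n
    unfolding x_def by (rule upper[rule_format]) (auto simp: a_def)
  moreover have "torally_separated (L * (1 + \<delta>) * (1 + 1 / 5)) x"
  proof (rule torally_separatedI)
    fix n m :: nat and \<theta> assume mn: "m < n" and \<theta>: "cmod \<theta> = 1"
    define c where "c k = a n k - \<theta> * a m k" for k
    define G where "G = {..Suc n}"
    have eq: "x n - \<theta> *\<^sub>C x m = (\<Sum>k\<in>G. c k *\<^sub>C u k)"
      unfolding x_eq[of n "Suc n", simplified] x_eq[of m "Suc n", OF less_imp_le_nat[OF Suc_less_eq[THEN iffD2, OF mn]]]
        complex_vector.scale_sum_right c_def G_def
      by (simp add: sum_subtractf complex_vector.scale_left_diff_distrib scaleC_scaleC)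
    have finG: "finite G" by (simp add: G_def)
    have fin: "finite ((\<lambda>k. cmod (c k)) ` G)" "(\<lambda>k. cmod (c k)) ` G \<noteq> {}" by (auto simp: G_def)
    obtain l where l: "l \<in> G" "\<And>k. k \<in> G \<Longrightarrow> cmod (c k) \<le> cmod (c l)"
    proof -
      obtain l where "l \<in> G" "cmod (c l) = Max ((\<lambda>k. cmod (c k)) ` G)"
        using Max_in[OF fin] by auto
      then show thesis using Max_ge[OF fin(1)] by (intro that[of l]) auto
    qed
    have "0 \<in> G" "Suc m \<in> G" using mn by (auto simp: G_def)
    moreover have "c 0 = 1 - \<theta>" "c (Suc m) = 1 + \<theta>" using mn by (auto simp: c_def a_def)
    ultimately have cl: "7 / 5 \<le> cmod (c l)"
      using l(2)[of 0] l(2)[of "Suc m"] cmod_one_minus_or_plus[OF \<theta>] by auto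
    \<comment> \<open>For \<open>\<delta> = 1 / 50\<close> and after division by \<open>L\<close>,
      this reads \<open>306 / 250 \<le> 329 / 250\<close>.\<close>
    have "L * (1 + \<delta>) * (1 + 1 / 5) \<le> 7 / 5 * (2 * (L * (1 - \<delta>)) - L * (1 + \<delta>))"
      using L by (simp add: \<delta>_def)
    also have "\<dots> \<le> cmod (c l) * (2 * (L * (1 - \<delta>)) - L * (1 + \<delta>))"
      using cl L by (intro mult_right_mono) (auto simp: \<delta>_def)
    also have "\<dots> \<le> norm (\<Sum>k\<in>G. c k *\<^sub>C u k)"
      using upper lower finG by (intro norm_sum_ge_coefficient[where c=c and l=l and G=G, OF finG l]) auto
    finally show "L * (1 + \<delta>) * (1 + 1 / 5) \<le> norm (x n - \<theta> *\<^sub>C x m)" using eq by simp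
  qed
  moreover have "0 < L * (1 + \<delta>)" using L by (simp add: \<delta>_def)
  ultimately show ?thesis by (intro torally_separated_normalize[where R="L * (1 + \<delta>)"]) auto
qed

section \<open>Passage to the complex statement\<close>

text \<open>A finite real spanning set would also span over the complex numbers, so infinite complex
  dimension gives the real one needed for the ultrafilter.\<close>

lemma real_span_subset_complex_span:
  fixes B :: "'a::complex_normed_vector set"
  shows "span B \<subseteq> complex_vector.span B"
proof (rule span_minimal)
  show "B \<subseteq> complex_vector.span B" by (rule complex_vector.span_superset)
  show "subspace (complex_vector.span B)"
    by (rule subspaceI)
      (auto simp: scaleR_scaleC intro: complex_vector.span_zero complex_vector.span_add complex_vector.span_scale)
qed

lemma dist_T_ge_iff:
  fixes x y :: "'a::complex_normed_vector"
  shows "dist_T x y \<ge> d \<longleftrightarrow> (\<forall>\<theta>. cmod \<theta> = 1 \<longrightarrow> norm (x - \<theta> *\<^sub>C y) \<ge> d)"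
proof -
  have "{\<theta>. cmod \<theta> = 1} \<noteq> {}" using norm_one by blast
  moreover have "bdd_below ((\<lambda>\<theta>. norm (x - \<theta> *\<^sub>C y)) ` {\<theta>. cmod \<theta> = 1})"
    by (intro bdd_belowI2[where m=0]) auto
  ultimately show ?thesis by (auto simp: dist_T_def le_cINF_iff)
qed

theorem theorem5p1:
  assumes "infinite_dimensional TYPE('a::complex_normed_vector)"
  shows "(\<exists>\<epsilon>>0. \<exists>x :: nat \<Rightarrow> 'a. (\<forall>n. norm (x n) = 1) \<and>
            (\<forall>n m. n \<noteq> m \<longrightarrow> (\<forall>\<theta>. cmod \<theta> = 1 \<longrightarrow> norm (x n - \<theta> *\<^sub>C x m) \<ge> 1 + \<epsilon>)))
       \<and> (\<forall>\<epsilon>>0. \<forall>x :: nat \<Rightarrow> 'a. (\<forall>n. norm (x n) = 1) \<longrightarrow>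
            ((\<forall>n m. n \<noteq> m \<longrightarrow> (\<forall>\<theta>. cmod \<theta> = 1 \<longrightarrow> norm (x n - \<theta> *\<^sub>C x m) \<ge> 1 + \<epsilon>)) \<longleftrightarrow>
             (\<forall>n m. n \<noteq> m \<longrightarrow> dist_T (x n) (x m) \<ge> 1 + \<epsilon>)))"
proof -
  have "\<not> no_torally_separated TYPE('a)"
  proof
    assume H: "no_torally_separated TYPE('a)"
    have "\<nexists>B::'a set. finite B \<and> span B = UNIV"
      using assms real_span_subset_complex_span unfolding infinite_dimensional_def
      by (metis top.extremum_uniqueI)
    from exists_weakly_null_ultrafilter[OF this]
    obtain U :: "'a filter" where "weakly_null_ultrafilter U"
      by (auto simp: weakly_null_ultrafilter_def)
    from weakly_null_ultrafilter.exists_weakly_unconditionally_Cauchy[OF this H]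
    obtain y :: "nat \<Rightarrow> 'a" where "\<forall>n. norm (y n) = 1"
      "\<forall>F e. finite F \<longrightarrow> (\<forall>j\<in>F. cmod (e j) \<le> 1) \<longrightarrow> norm (\<Sum>j\<in>F. e j *\<^sub>C y j) \<le> 40"
      by (elim exE conjE)
    then have "\<exists>x::nat \<Rightarrow> 'a. (\<forall>n. norm (x n) = 1) \<and> torally_separated (1 + 1 / 5) x"
      by (intro torally_separated_of_bounded_sums[of y 40]) auto
    moreover have "(0::real) < 1 / 5" by simp
    ultimately show False using H unfolding no_torally_separated_def by blast
  qed
  then show ?thesis
    unfolding no_torally_separated_def torally_separated_def not_not dist_T_ge_iff by blast
qed

end
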